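(* Let $m\ge9$ with $3\mid m$, and let $f(x)=x^{t_1}+x^{t_2}$ on $\mathbb{F}_{2^m}$, where $t_1,t_2\in\{2^{\frac m3}+1,\,2^{\frac{2m}{3}}+1,\,2^{\frac{2m}{3}}+2^{\frac m3}\}$ and $t_1\ne t_2$. Let $D=\{x\in\mathbb{F}_{2^m}^*:\mathrm{Tr}(x)=1\}$ and $\mathcal{C}(f)^{\bar D}=\{(\mathrm{Tr}(af(x)+bx))_{x\in D}:a,b\in\mathbb{F}_{2^m}\}$. Then $\mathcal{C}(f)^{\bar D}$ is a $[2^{m-1},\frac{5m}{3},2^{m-2}-2^{\frac{2m}{3}-1}]$ binary code with weight distribution: weight $0$ once; weight $2^{m-2}$ with multiplicity $2^{\frac{5m}{3}}-2^{\frac{4m}{3}-1}+2^{\frac{2m}{3}-1}-2$; each of the weights $2^{m-2}\pm2^{\frac{2m}{3}-1}$ with multiplicity $2^{\frac{4m}{3}-2}-2^{\frac{2m}{3}-2}$; weight $2^{m-1}$ once. Its dual has parameters $[2^{m-1},2^{m-1}-\frac{5m}{3},4]$ and is distance-optimal with respect to the sphere packing bound.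
   Context: $\mathrm{Tr}$ is the absolute trace from $\mathbb{F}_{2^m}$ to $\mathbb{F}_2$. An $[n,k,d]$ binary code is a $k$-dimensional linear subspace of $\mathbb{F}_2^n$ with minimum Hamming distance $d$; the dual is taken with respect to the standard inner product. The multiplicity of a weight is the number of codewords of that weight. An $[n,k,d]$ binary code is distance-optimal if there is no $[n,k,d']$ binary linear code with $d'\ge d+1$; the phrase "with respect to the sphere packing bound" asserts distance-optimality in this sense, and names the bound $2^n\ge 2^k\sum_{i=0}^{\lfloor (d-1)/2\rfloor}\binom ni$ (valid for every $[n,k,d]$ binary code) as the bound used to establish it. The notation $\mathcal{C}(f)^{\bar D}$ indicates puncturing on $\bar D=\mathbb{F}_{2^m}^*\setminus D$. *)

theory Defs
  imports
    "HOL-Library.Z2"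
    "HOL-Library.Function_Algebras"
    "HOL-Library.Cardinality"
    "HOL-Number_Theory.Residues"
begin

section \<open>Binary linear codes\<close>

text \<open>
  The coordinates of a word are indexed by a finite set \<open>I\<close>, so that a code may be indexed
  by a subset of a field.  A word is a function into the field \<^typ>\<open>bit\<close> that vanishes
  outside \<open>I\<close>; thus the words over \<open>I\<close> are a copy of the space of bit vectors of length
  \<open>card I\<close>, and addition is the pointwise addition of \<^theory>\<open>HOL-Library.Function_Algebras\<close>.
\<close>

definition words :: "'i set \<Rightarrow> ('i \<Rightarrow> bit) set" where
  "words I = {v. \<forall>i. i \<notin> I \<longrightarrow> v i = 0}"

definition scale_word :: "bit \<Rightarrow> ('i \<Rightarrow> bit) \<Rightarrow> 'i \<Rightarrow> bit" where
  "scale_word c v = (\<lambda>i. c * v i)"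

interpretation word: vector_space scale_word
  by unfold_locales (simp_all only: scale_word_def plus_fun_def distrib_left distrib_right mult.assoc mult_1_left)

definition hamming_dist :: "'i set \<Rightarrow> ('i \<Rightarrow> bit) \<Rightarrow> ('i \<Rightarrow> bit) \<Rightarrow> nat" where
  "hamming_dist I u v = card {i \<in> I. u i \<noteq> v i}"

definition hamming_weight :: "'i set \<Rightarrow> ('i \<Rightarrow> bit) \<Rightarrow> nat" where
  "hamming_weight I v = card {i \<in> I. v i \<noteq> 0}"

text \<open>A code with fewer than two codewords has no minimum distance.\<close>

definition has_min_dist :: "'i set \<Rightarrow> ('i \<Rightarrow> bit) set \<Rightarrow> nat \<Rightarrow> bool" where
  "has_min_dist I C d \<longleftrightarrow>
     (\<exists>u\<in>C. \<exists>v\<in>C. u \<noteq> v \<and> hamming_dist I u v = d) \<and>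
     (\<forall>u\<in>C. \<forall>v\<in>C. u \<noteq> v \<longrightarrow> d \<le> hamming_dist I u v)"

definition binary_code :: "'i set \<Rightarrow> ('i \<Rightarrow> bit) set \<Rightarrow> nat \<Rightarrow> nat \<Rightarrow> nat \<Rightarrow> bool" where
  "binary_code I C n k d \<longleftrightarrow>
     finite I \<and> card I = n \<and>
     C \<subseteq> words I \<and> word.subspace C \<and> word.dim C = k \<and>
     has_min_dist I C d"

definition dual_code :: "'i set \<Rightarrow> ('i \<Rightarrow> bit) set \<Rightarrow> ('i \<Rightarrow> bit) set" where
  "dual_code I C = {u \<in> words I. \<forall>c\<in>C. (\<Sum>i\<in>I. u i * c i) = 0}"

definition weight_multiplicity :: "'i set \<Rightarrow> ('i \<Rightarrow> bit) set \<Rightarrow> nat \<Rightarrow> nat" where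
  "weight_multiplicity I C w = card {c \<in> C. hamming_weight I c = w}"

text \<open>
  The competing codes of the same length are taken over the standard coordinates
  \<open>0, \<dots>, n - 1\<close>; every code of length \<open>n\<close> is equivalent to one of these by
  relabelling its coordinates.
\<close>

definition distance_optimal :: "'i set \<Rightarrow> ('i \<Rightarrow> bit) set \<Rightarrow> nat \<Rightarrow> nat \<Rightarrow> nat \<Rightarrow> bool" where
  "distance_optimal I C n k d \<longleftrightarrow>
     binary_code I C n k d \<and>
     \<not> (\<exists>(C' :: (nat \<Rightarrow> bit) set) d'. d' \<ge> d + 1 \<and> binary_code {..<n} C' n k d')"


section \<open>The absolute trace and the punctured code\<close>

text \<open>
  The sum of conjugates lies in the prime subfield \<open>{0, 1}\<close>; \<open>abs_trace\<close> is the
  element of \<^typ>\<open>bit\<close> corresponding to it (see \<open>of_bit_abs_trace\<close> below).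
\<close>

definition abs_trace :: "nat \<Rightarrow> 'a::field \<Rightarrow> bit" where
  "abs_trace m x = (THE c. (of_bit c :: 'a) = (\<Sum>i<m. x ^ (2 ^ i)))"

lemma two_eq_zero_of_card:
  assumes "CARD('a::finite_field) = 2 ^ m"
  shows "(2::'a) = 0"
proof -
  have "CHAR('a) dvd 2 ^ m"
    using CHAR_dvd_CARD[where 'a = 'a] assms by simp
  moreover have "prime CHAR('a)"
    by (rule prime_CHAR_semidom) (simp add: finite_imp_CHAR_pos)
  ultimately have "CHAR('a) = 2"
    using prime_dvd_power primes_dvd_imp_eq two_is_prime_nat by blast
  thus ?thesis
    using of_nat_CHAR[where 'a = 'a] by simp
qed

lemma of_bit_abs_trace:
  fixes x :: "'a::finite_field"
  assumes card: "CARD('a) = 2 ^ m"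
  shows "of_bit (abs_trace m x) = (\<Sum>i<m. x ^ (2 ^ i))"
proof -
  have two: "(2::'a) = 0" by (rule two_eq_zero_of_card[OF card])
  have sq_add: "(a + b) ^ 2 = a ^ 2 + b ^ 2" for a b :: 'a
    by (simp add: power2_sum two)
  have sq: "(\<Sum>i<k. x ^ (2 ^ i)) ^ 2 = (\<Sum>i<k. x ^ (2 ^ Suc i))" for k
    by (induction k) (simp_all add: sq_add power_mult[symmetric] mult.commute)
  let ?s = "\<Sum>i<m. x ^ (2 ^ i)"
  have "x + ?s ^ 2 = (\<Sum>i<Suc m. x ^ (2 ^ i))"
    unfolding sq by (subst sum.lessThan_Suc_shift) simp
  also have "\<dots> = ?s + x"
    using finite_field_power_card_eq_same[of x] card by simp
  finally have "?s * (?s - 1) = 0"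
    by (simp add: power2_eq_square algebra_simps)
  hence s: "?s = 0 \<or> ?s = 1" by simp
  have "\<exists>!c. (of_bit c :: 'a) = ?s"
  proof (rule ex_ex1I)
    show "\<exists>c. (of_bit c :: 'a) = ?s"
      using s by (metis of_bool_eq(1,2) even_zero odd_one)
  next
    fix c d :: bit
    assume "(of_bit c :: 'a) = ?s" "(of_bit d :: 'a) = ?s"
    thus "c = d" by (cases c; cases d) auto
  qed
  thus ?thesis
    unfolding abs_trace_def by (rule theI')
qed

text \<open>\<open>punctured_code m f D\<close> is the code obtained from \<open>f\<close> by keeping the coordinates in \<open>D\<close>.\<close>

definition punctured_code :: "nat \<Rightarrow> ('a::field \<Rightarrow> 'a) \<Rightarrow> 'a set \<Rightarrow> ('a \<Rightarrow> bit) set" where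
  "punctured_code m f D =
     {\<lambda>x. if x \<in> D then abs_trace m (a * f x + b * x) else 0 | a b. True}"

end

theory Submission
  imports Defs "HOL-Computational_Algebra.Polynomial"
begin

text \<open>
  Put \<open>q = 2 ^ k\<close> with \<open>m = 3 * k\<close> and \<open>u = x ^ (q + 1)\<close>.  The three admissible powers of \<open>x\<close> are
  the conjugates of \<open>u\<close> over \<open>GF(q)\<close>, so the code consists of the words \<open>Tr (c * u + b * x)\<close> with
  \<open>c\<close> in the \<open>q\<^sup>2\<close>-element set \<open>L = {a + a ^ q}\<close>, the kernel of the relative trace.  Let \<open>S c b\<close> be
  the character sum of such a form over the whole field.  For \<open>c \<noteq> 0\<close> in \<open>L\<close> the radical of the
  form is \<open>GF(q) * c ^ q\<close>, on which \<open>Tr\<close> vanishes; hence \<open>S c (b + 1)\<close> and \<open>S c b\<close> have the same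
  square, which is \<open>0\<close> or \<open>q ^ 4\<close>.  Four times the weight is \<open>q ^ 3 + S c (b + 1) - S c b\<close>, and this
  leaves three weights for each such \<open>c\<close>.  Their frequencies follow from the second moment over \<open>b\<close>
  and the symmetry \<open>b \<mapsto> b + 1\<close>, which negates the difference.

  A nonzero dual word has support \<open>T\<close> with \<open>\<Sum>T = 0\<close> and, as \<open>Tr = 1\<close> on \<open>D\<close>, of even size, so
  its weight is at least \<open>4\<close>.  The sphere packing bound with radius \<open>2\<close> excludes \<open>d \<ge> 5\<close> because
  \<open>m \<ge> 9\<close>; this gives both the exact minimum distance and the optimality of the dual.
\<close>

section \<open>Characters and binary codes\<close>

text \<open>Left in place, these rules rewrite the field operations on bits to \<open>XOR\<close> and \<open>AND\<close>.\<close>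

declare add_bit_eq_xor [simp del] mult_bit_eq_and [simp del]

lemma bit_add_self [simp]: "c + c = (0::bit)"
  by (cases c) simp_all

definition bit_sign :: "bit \<Rightarrow> int" where
  "bit_sign c = (if c = 0 then 1 else - 1)"

lemma bit_sign_simps [simp]: "bit_sign 0 = 1" "bit_sign 1 = - 1"
  by (simp_all add: bit_sign_def)

lemma bit_sign_add: "bit_sign (c + d) = bit_sign c * bit_sign d"
  by (cases c; cases d) simp_all

text \<open>Orthogonality of characters: if \<open>h w = 1\<close> for some \<open>w\<close> in
  \<open>V\<close>, translation by \<open>w\<close> permutes \<open>V\<close> and flips every sign,
  so the sum equals its own negative.\<close>

lemma sum_bit_sign:
  fixes h :: "'b::ab_group_add \<Rightarrow> bit"
  assumes fin: "finite V"
    and closed: "\<And>x y. x \<in> V \<Longrightarrow> y \<in> V \<Longrightarrow> x + y \<in> V"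
    and add: "\<And>x y. x \<in> V \<Longrightarrow> y \<in> V \<Longrightarrow> h (x + y) = h x + h y"
  shows "(\<Sum>v\<in>V. bit_sign (h v)) = (if \<forall>v\<in>V. h v = 0 then int (card V) else 0)"
proof (cases "\<forall>v\<in>V. h v = 0")
  case True
  then show ?thesis by simp
next
  case False
  then obtain w where w: "w \<in> V" "h w = 1" by auto
  have "(+) w ` V = V"
    by (rule endo_inj_surj) (use fin closed w in auto)
  then have "bij_betw ((+) w) V V"
    by (simp add: bij_betw_def)
  then have "(\<Sum>v\<in>V. bit_sign (h v)) = (\<Sum>v\<in>V. bit_sign (h (w + v)))"
    by (rule sum.reindex_bij_betw[symmetric])
  also have "\<dots> = - (\<Sum>v\<in>V. bit_sign (h v))"
    using w by (simp add: add bit_sign_add sum_negf)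
  finally show ?thesis using False by auto
qed

section \<open>Words, subspaces and duals by counting\<close>

lemma words_add: "u \<in> words I \<Longrightarrow> v \<in> words I \<Longrightarrow> u + v \<in> words I"
  by (simp add: words_def)

lemma bij_betw_words_Pow: "bij_betw (\<lambda>v. {i. v i \<noteq> 0}) (words I) (Pow I)"
proof (rule bij_betwI[where g = "\<lambda>S i. of_bool (i \<in> S)"])
  show "(\<lambda>i. of_bool (i \<in> {i. v i \<noteq> 0})) = v" if "v \<in> words I" for v
  proof
    fix i show "of_bool (i \<in> {i. v i \<noteq> 0}) = v i" by (cases "v i") simp_all
  qed
qed (auto simp: words_def)

lemma finite_words: "finite I \<Longrightarrow> finite (words I)"
  using bij_betw_finite[OF bij_betw_words_Pow, of I] by simp

lemma card_words: "finite I \<Longrightarrow> card (words I) = 2 ^ card I"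
  using bij_betw_same_card[OF bij_betw_words_Pow, of I] by (simp add: card_Pow)

text \<open>Over the two-element field a linear combination of a basis \<open>B\<close> is a subset
  sum, so \<open>Pow B\<close> is in bijection with \<open>V\<close>.\<close>

lemma card_subspace:
  assumes fin: "finite V" and sub: "word.subspace V"
  shows "card V = 2 ^ word.dim V"
proof -
  obtain B where B: "B \<subseteq> V" "word.independent B" "V \<subseteq> word.span B" "card B = word.dim V"
    by (rule word.basis_exists)
  have finB: "finite B" using B(1) fin by (rule finite_subset)
  have span: "word.span B = V"
    using B sub by (simp add: subset_antisym word.span_minimal)
  \<comment> \<open>Indicator coefficients present a subset sum as a linear combination, to which
    independence and the description of the span apply.\<close>
  have sum_scale: "(\<Sum>v\<in>B. scale_word (of_bool (v \<in> S)) v) = \<Sum>S" if "S \<subseteq> B" for S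
  proof -
    have "(\<Sum>v\<in>B. scale_word (of_bool (v \<in> S)) v) = (\<Sum>v\<in>S. scale_word (of_bool (v \<in> S)) v)"
      by (rule sum.mono_neutral_right) (use finB that in \<open>auto simp: scale_word_def zero_fun_def\<close>)
    also have "\<dots> = \<Sum>S" by (rule sum.cong) (simp_all add: scale_word_def)
    finally show ?thesis .
  qed
  have "inj_on \<Sum> (Pow B)"
  proof (rule inj_onI)
    fix S T assume ST: "S \<in> Pow B" "T \<in> Pow B" "\<Sum>S = \<Sum>T"
    have "(\<Sum>v\<in>B. scale_word (of_bool (v \<in> S) - of_bool (v \<in> T)) v) = 0"
      unfolding word.scale_left_diff_distrib sum_subtractf using ST by (simp only: sum_scale Pow_iff) simp
    then have "of_bool (v \<in> S) - of_bool (v \<in> T) = (0::bit)" if "v \<in> B" for v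
      using word.independentD[OF B(2) finB subset_refl, of "\<lambda>v. of_bool (v \<in> S) - of_bool (v \<in> T)" v]
        that by blast
    then have "v \<in> S \<longleftrightarrow> v \<in> T" if "v \<in> B" for v
      using that by (metis eq_iff_diff_eq_0 of_bool_eq_iff)
    then show "S = T" using ST by blast
  qed
  moreover have "\<Sum> ` Pow B = V"
  proof
    show "\<Sum> ` Pow B \<subseteq> V"
      using B(1) sub by (auto intro!: word.subspace_sum)
    show "V \<subseteq> \<Sum> ` Pow B"
    proof
      fix v assume "v \<in> V"
      then obtain u where u: "v = (\<Sum>x\<in>B. scale_word (u x) x)"
        using word.span_finite[OF finB] span by auto
      have "of_bool (x \<in> {x \<in> B. u x = 1}) = u x" if "x \<in> B" for x
        using that by (cases "u x") simp_all
      then have "v = (\<Sum>x\<in>B. scale_word (of_bool (x \<in> {x \<in> B. u x = 1})) x)"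
        using u by simp
      also have "\<dots> = \<Sum>{x \<in> B. u x = 1}" by (rule sum_scale) blast
      finally show "v \<in> \<Sum> ` Pow B" by blast
    qed
  qed
  ultimately have "card V = card (Pow B)" by (metis card_image)
  then show ?thesis using finB B(4) by (simp add: card_Pow)
qed

lemma dim_of_card:
  assumes "finite V" "word.subspace V" "card V = 2 ^ k"
  shows "word.dim V = k"
  using card_subspace[OF assms(1,2)] assms(3) by simp

lemma subspace_dual_code: "word.subspace (dual_code I C)"
  by (rule word.subspaceI)
    (auto simp: dual_code_def words_def scale_word_def distrib_right sum.distrib mult.assoc
      simp flip: sum_distrib_left)

text \<open>Double counting of the signs of all inner products of words \<open>u\<close> with
  codewords \<open>c\<close>. Summing over \<open>c\<close> first leaves \<open>card C\<close> for
  each \<open>u\<close> in the dual; summing over \<open>u\<close> first leaves only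
  \<open>c = 0\<close>, with contribution \<open>2 ^ card I\<close>.\<close>

lemma card_dual_code:
  assumes fin: "finite I" and C: "C \<subseteq> words I" and sub: "word.subspace C"
  shows "card (dual_code I C) * card C = 2 ^ card I"
proof -
  have finW: "finite (words I)" using fin by (rule finite_words)
  have finC: "finite C" using C finW by (rule finite_subset)
  define p where "p u c = (\<Sum>i\<in>I. u i * c i)" for u c :: "'a \<Rightarrow> bit"
  have p_add: "p (u + u') c = p u c + p u' c" "p u (c + c') = p u c + p u c'" for u u' c c'
    by (simp_all add: p_def distrib_right distrib_left sum.distrib)
  have inner: "(\<Sum>c\<in>C. bit_sign (p u c)) = (if \<forall>c\<in>C. p u c = 0 then int (card C) else 0)" for u
    by (rule sum_bit_sign[OF finC]) (use sub in \<open>auto simp: p_add word.subspace_add\<close>)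
  have outer: "(\<Sum>u\<in>words I. bit_sign (p u c)) = (if c = 0 then 2 ^ card I else 0)"
    if c: "c \<in> C" for c
  proof -
    have "(\<forall>u\<in>words I. p u c = 0) \<longleftrightarrow> c = 0"
    proof
      assume *: "\<forall>u\<in>words I. p u c = 0"
      show "c = 0"
      proof
        fix i
        show "c i = 0 i"
        proof (cases "i \<in> I")
          case True
          define e where "e = (\<lambda>j. of_bool (j = i) :: bit)"
          have "p e c = (\<Sum>j\<in>I. if j = i then c j else 0)"
            unfolding p_def e_def by (rule sum.cong) auto
          then have "p e c = c i" using fin True by simp
          moreover have "e \<in> words I" using True by (auto simp: words_def e_def)
          ultimately show ?thesis using * by simp
        next
          case False then show ?thesis using c C by (auto simp: words_def)
        qed
      qed
    qed (simp add: p_def)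
    moreover have "(\<Sum>u\<in>words I. bit_sign (p u c))
        = (if \<forall>u\<in>words I. p u c = 0 then int (card (words I)) else 0)"
      by (rule sum_bit_sign[OF finW]) (auto simp: words_add p_add)
    ultimately show ?thesis using fin by (simp add: card_words)
  qed
  have "int (card (dual_code I C) * card C) = (\<Sum>u\<in>dual_code I C. int (card C))"
    by simp
  also have "\<dots> = (\<Sum>u\<in>words I. if \<forall>c\<in>C. p u c = 0 then int (card C) else 0)"
    by (rule sum.mono_neutral_cong_left) (auto simp: dual_code_def p_def finW)
  also have "\<dots> = (\<Sum>c\<in>C. \<Sum>u\<in>words I. bit_sign (p u c))"
    unfolding inner[symmetric] by (rule sum.swap)
  also have "\<dots> = (\<Sum>c\<in>C. if c = 0 then 2 ^ card I else 0)"
    by (rule sum.cong) (simp_all add: outer)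
  also have "\<dots> = 2 ^ card I"
    using finC word.subspace_0[OF sub] by simp
  finally have "int (card (dual_code I C) * card C) = int (2 ^ card I)"
    by simp
  then show ?thesis by (simp only: of_nat_eq_iff)
qed

lemma dim_dual_code:
  assumes fin: "finite I" and C: "C \<subseteq> words I" and sub: "word.subspace C"
  shows "word.dim (dual_code I C) = card I - word.dim C"
proof -
  have finC: "finite C" "finite (dual_code I C)"
    using C finite_words[OF fin] by (auto simp: dual_code_def intro: finite_subset)
  have "2 ^ (word.dim (dual_code I C) + word.dim C) = (2::nat) ^ card I"
    using card_dual_code[OF assms] card_subspace[OF finC(1) sub]
      card_subspace[OF finC(2) subspace_dual_code]
    by (simp add: power_add)
  then have "word.dim (dual_code I C) + word.dim C = card I" by simp
  then show ?thesis by simp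
qed

section \<open>Hamming distance, balls and the sphere packing bound\<close>

lemma hamming_dist_commute: "hamming_dist I u v = hamming_dist I v u"
  by (simp add: hamming_dist_def eq_commute)

lemma hamming_dist_triangle:
  assumes "finite I"
  shows "hamming_dist I u w \<le> hamming_dist I u v + hamming_dist I v w"
proof -
  have "{i \<in> I. u i \<noteq> w i} \<subseteq> {i \<in> I. u i \<noteq> v i} \<union> {i \<in> I. v i \<noteq> w i}"
    by auto
  then have "card {i \<in> I. u i \<noteq> w i} \<le> card ({i \<in> I. u i \<noteq> v i} \<union> {i \<in> I. v i \<noteq> w i})"
    using assms by (intro card_mono) auto
  also have "\<dots> \<le> card {i \<in> I. u i \<noteq> v i} + card {i \<in> I. v i \<noteq> w i}"
    by (rule card_Un_le)
  finally show ?thesis by (simp add: hamming_dist_def)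
qed

lemma hamming_dist_eq_weight: "hamming_dist I u v = hamming_weight I (u + v)"
proof -
  have "u i \<noteq> v i \<longleftrightarrow> u i + v i \<noteq> 0" for i
    by (cases "u i"; cases "v i") simp_all
  then show ?thesis by (simp add: hamming_dist_def hamming_weight_def)
qed

lemma has_min_dist_iff_weight:
  assumes sub: "word.subspace C"
  shows "has_min_dist I C d \<longleftrightarrow>
    (\<exists>v\<in>C. v \<noteq> 0 \<and> hamming_weight I v = d) \<and> (\<forall>v\<in>C. v \<noteq> 0 \<longrightarrow> d \<le> hamming_weight I v)"
proof -
  have add: "u + v \<in> C" if "u \<in> C" "v \<in> C" for u v
    using sub that by (rule word.subspace_add)
  have eq: "u + v = 0 \<longleftrightarrow> u = v" for u v :: "'a \<Rightarrow> bit"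
  proof -
    have "u i + v i = 0 \<longleftrightarrow> u i = v i" for i by (cases "u i"; cases "v i") simp_all
    then show ?thesis by (simp add: fun_eq_iff)
  qed
  have zero: "0 \<in> C" using sub by (rule word.subspace_0)
  \<comment> \<open>Used for two predicates: having weight \<open>d\<close> gives attainment, and
    having weight below \<open>d\<close> gives, by negation, the lower bound.\<close>
  have *: "(\<exists>u\<in>C. \<exists>v\<in>C. u \<noteq> v \<and> P (u + v)) \<longleftrightarrow> (\<exists>v\<in>C. v \<noteq> 0 \<and> P v)" for P
  proof
    show "\<exists>v\<in>C. v \<noteq> 0 \<and> P v" if "\<exists>u\<in>C. \<exists>v\<in>C. u \<noteq> v \<and> P (u + v)"
      using that add eq by blast
    show "\<exists>u\<in>C. \<exists>v\<in>C. u \<noteq> v \<and> P (u + v)" if "\<exists>v\<in>C. v \<noteq> 0 \<and> P v"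
      using that zero add_0 by metis
  qed
  show ?thesis
    unfolding has_min_dist_def hamming_dist_eq_weight
    using *[of "\<lambda>v. hamming_weight I v = d"] *[of "\<lambda>v. \<not> d \<le> hamming_weight I v"] by blast
qed

lemma ex_min_dist:
  assumes "u \<in> C" "v \<in> C" "u \<noteq> v"
  shows "\<exists>d. has_min_dist I C d"
proof -
  let ?P = "\<lambda>d. \<exists>u\<in>C. \<exists>v\<in>C. u \<noteq> v \<and> hamming_dist I u v = d"
  have "?P (LEAST d. ?P d)" by (rule LeastI[of ?P "hamming_dist I u v"]) (use assms in blast)
  moreover have "(LEAST d. ?P d) \<le> hamming_dist I u v" if "u \<in> C" "v \<in> C" "u \<noteq> v" for u v
    by (rule Least_le) (use that in blast)
  ultimately show ?thesis unfolding has_min_dist_def by blast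
qed

text \<open>Translation by \<open>u\<close> moves the ball to the origin, where taking supports
  identifies it with the subsets of \<open>I\<close> of size at most \<open>t\<close>.\<close>

lemma card_hamming_ball:
  assumes fin: "finite I" and u: "u \<in> words I"
  shows "card {v \<in> words I. hamming_dist I u v \<le> t} = (\<Sum>i\<le>t. card I choose i)"
proof -
  have "bij_betw ((+) u) {w \<in> words I. hamming_weight I w \<le> t} {v \<in> words I. hamming_dist I u v \<le> t}"
  proof (rule bij_betwI[where g = "(+) u"])
    have *: "u + (u + w) = w" for w by (simp add: fun_eq_iff flip: add.assoc)
    show "u + (u + w) = w" "u + (u + w) = w" for w by (rule *)+
    show "(+) u \<in> {w \<in> words I. hamming_weight I w \<le> t} \<rightarrow> {v \<in> words I. hamming_dist I u v \<le> t}"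
      using u by (auto simp: words_add hamming_dist_eq_weight *)
    show "(+) u \<in> {v \<in> words I. hamming_dist I u v \<le> t} \<rightarrow> {w \<in> words I. hamming_weight I w \<le> t}"
      using u by (auto simp: words_add hamming_dist_eq_weight)
  qed
  then have "card {v \<in> words I. hamming_dist I u v \<le> t} = card {w \<in> words I. hamming_weight I w \<le> t}"
    by (rule bij_betw_same_card[symmetric])
  also have "\<dots> = card {S. S \<subseteq> I \<and> card S \<le> t}"
  proof (rule bij_betw_same_card)
    have weight: "hamming_weight I w = card {i. w i \<noteq> 0}" if "w \<in> words I" for w
      using that unfolding hamming_weight_def words_def by (intro arg_cong[where f = card]) auto
    show "bij_betw (\<lambda>v. {i. v i \<noteq> 0}) {w \<in> words I. hamming_weight I w \<le> t}
        {S. S \<subseteq> I \<and> card S \<le> t}"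
    proof (rule bij_betw_subset[OF bij_betw_words_Pow])
      have "(\<lambda>v. {i. v i \<noteq> 0}) ` {w \<in> words I. hamming_weight I w \<le> t}
          = {S \<in> (\<lambda>v. {i. v i \<noteq> 0}) ` words I. card S \<le> t}"
        by (auto simp: weight simp del: bit_not_zero_iff)
      then show "(\<lambda>v. {i. v i \<noteq> 0}) ` {w \<in> words I. hamming_weight I w \<le> t}
          = {S. S \<subseteq> I \<and> card S \<le> t}"
        using bij_betw_words_Pow[of I] by (auto simp: bij_betw_def)
    qed auto
  qed
  also have "{S. S \<subseteq> I \<and> card S \<le> t} = (\<Union>i\<le>t. {S. S \<subseteq> I \<and> card S = i})"
    by auto
  also have "card \<dots> = (\<Sum>i\<le>t. card {S. S \<subseteq> I \<and> card S = i})"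
    by (rule card_UN_disjoint) (use fin in auto)
  also have "\<dots> = (\<Sum>i\<le>t. card I choose i)"
    by (simp add: n_subsets[OF fin])
  finally show ?thesis .
qed

text \<open>By the triangle inequality the balls of radius \<open>t\<close> around distinct
  codewords are disjoint, and all of them lie in \<open>words I\<close>.\<close>

lemma sphere_packing:
  assumes code: "binary_code I C n k d" and d: "2 * t < d"
  shows "2 ^ k * (\<Sum>i\<le>t. n choose i) \<le> 2 ^ n"
proof -
  have fin: "finite I" and n: "card I = n" and C: "C \<subseteq> words I"
    and sub: "word.subspace C" and dim: "word.dim C = k" and dist: "has_min_dist I C d"
    using code by (auto simp: binary_code_def)
  let ?B = "\<lambda>u. {v \<in> words I. hamming_dist I u v \<le> t}"
  have finW: "finite (words I)" using fin by (rule finite_words)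
  have finC: "finite C" using C finW by (rule finite_subset)
  have disj: "?B u \<inter> ?B v = {}" if "u \<in> C" "v \<in> C" "u \<noteq> v" for u v
  proof (rule ccontr)
    assume "?B u \<inter> ?B v \<noteq> {}"
    then obtain w where "hamming_dist I u w \<le> t" "hamming_dist I v w \<le> t" by auto
    then have "hamming_dist I u v \<le> 2 * t"
      using hamming_dist_triangle[OF fin, of u v w] by (simp add: hamming_dist_commute)
    moreover have "d \<le> hamming_dist I u v"
      using dist that by (auto simp: has_min_dist_def)
    ultimately show False using d by simp
  qed
  have "2 ^ k * (\<Sum>i\<le>t. n choose i) = (\<Sum>u\<in>C. card (?B u))"
    using C by (subst sum.cong[OF refl card_hamming_ball[OF fin]])
      (auto simp: n card_subspace[OF finC sub] dim)
  also have "\<dots> = card (\<Union>u\<in>C. ?B u)"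
    by (rule card_UN_disjoint[symmetric]) (use finC finW disj in auto)
  also have "\<dots> \<le> card (words I)"
    by (rule card_mono) (use finW in auto)
  finally show ?thesis using fin n by (simp add: card_words)
qed

section \<open>The absolute trace\<close>

text \<open>Iterated Frobenius automorphism. In a field with \<open>2 ^ (3 * k)\<close> elements,
  \<open>frob k\<close> generates the automorphisms over the subfield of order
  \<open>2 ^ k\<close>.\<close>

definition frob :: "nat \<Rightarrow> 'a::field \<Rightarrow> 'a" where
  "frob j x = x ^ (2 ^ j)"

context
  fixes m :: nat
  assumes card: "CARD('a::finite_field) = 2 ^ m"
begin

lemma char_two_add_self: "x + x = (0::'a)"
  using two_eq_zero_of_card[OF card] by (metis mult_2 mult_zero_left)

lemma char_two_add_eq_0_iff: "x + y = 0 \<longleftrightarrow> x = (y::'a)"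
  using char_two_add_self by (metis add_left_cancel)

lemma frob_add: "frob j (x + y) = frob j x + frob j (y::'a)"
proof (induction j)
  case (Suc j)
  have "frob (Suc j) z = (frob j z)\<^sup>2" for z :: 'a
    by (simp add: frob_def power_mult mult.commute[of 2] flip: power_mult)
  then show ?case
    by (simp add: Suc power2_sum two_eq_zero_of_card[OF card])
qed (simp add: frob_def)

lemma extension_degree_pos: "0 < m"
proof (rule ccontr)
  assume "\<not> 0 < m"
  then have "card (UNIV::'a set) = 1" using card by simp
  then have "(0::'a) = 1" by (metis UNIV_I card_1_singletonE singletonD)
  then show False by simp
qed

lemma of_bit_inject: "(of_bit c :: 'a) = of_bit d \<longleftrightarrow> c = d"
  by (cases c; cases d) simp_all

lemma abs_trace_add: "abs_trace m (x + y) = abs_trace m x + abs_trace m (y::'a)"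
proof -
  have "(of_bit (c + d) :: 'a) = of_bit c + of_bit d" for c d
    by (cases c; cases d) (simp_all add: char_two_add_self two_eq_zero_of_card[OF card])
  moreover have "of_bit (abs_trace m (x + y)) = of_bit (abs_trace m x) + (of_bit (abs_trace m y) :: 'a)"
    unfolding of_bit_abs_trace[OF card] using frob_add[of _ x y]
    by (simp add: frob_def sum.distrib)
  ultimately show ?thesis by (metis of_bit_inject)
qed

lemma abs_trace_0: "abs_trace m (0::'a) = 0"
  using abs_trace_add[of 0 0] by simp

text \<open>Squaring permutes the conjugates cyclically, because
  \<open>x ^ (2 ^ m) = x\<close>.\<close>

lemma abs_trace_frob: "abs_trace m (frob j x) = abs_trace m (x::'a)"
proof -
  have sq: "abs_trace m (x\<^sup>2) = abs_trace m x" for x :: 'a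
  proof -
    have "x + (\<Sum>i<m. (x\<^sup>2) ^ (2 ^ i)) = (\<Sum>i<Suc m. x ^ (2 ^ i))"
      by (subst sum.lessThan_Suc_shift) (simp flip: power_mult)
    also have "\<dots> = (\<Sum>i<m. x ^ (2 ^ i)) + x"
      using finite_field_power_card_eq_same[of x] card by simp
    finally show ?thesis
      by (metis of_bit_abs_trace[OF card] of_bit_inject add.commute add_left_cancel)
  qed
  show ?thesis
  proof (induction j)
    case (Suc j)
    have "frob (Suc j) x = (frob j x)\<^sup>2"
      by (simp add: frob_def mult.commute[of 2] flip: power_mult)
    with Suc show ?case by (simp only: sq)
  qed (simp add: frob_def)
qed

section \<open>Surjectivity and nondegeneracy of the trace\<close>

lemma card_poly_roots_le:
  fixes p :: "'a poly"
  assumes "coeff p i \<noteq> 0" "degree p \<le> n" "\<And>x. x \<in> A \<Longrightarrow> poly p x = 0"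
  shows "card A \<le> n"
proof -
  have "p \<noteq> 0" using assms(1) by auto
  then have "card {x. poly p x = 0} \<le> degree p" by (rule card_poly_roots_bound)
  moreover have "card A \<le> card {x. poly p x = 0}"
    by (rule card_mono) (use assms(3) in auto)
  ultimately show ?thesis using assms(2) by simp
qed

text \<open>Otherwise the trace polynomial, nonzero and of degree at most
  \<open>2 ^ (m - 1)\<close>, would vanish on all \<open>2 ^ m\<close> field elements.\<close>

lemma abs_trace_surj: "\<exists>x::'a. abs_trace m x = 1"
proof (rule ccontr)
  assume "\<nexists>x::'a. abs_trace m x = 1"
  then have zero: "(\<Sum>i<m. x ^ (2 ^ i)) = 0" for x :: 'a
    unfolding of_bit_abs_trace[OF card, symmetric] by simp
  define p where "p = (\<Sum>i<m. monom (1::'a) (2 ^ i))"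
  have "card (UNIV::'a set) \<le> 2 ^ (m - 1)"
  proof (rule card_poly_roots_le)
    \<comment> \<open>Only the summand \<open>i = 0\<close> has exponent \<open>1\<close>, so this
      coefficient is \<open>1\<close> and \<open>p\<close> is not zero.\<close>
    have "coeff p 1 = (\<Sum>i<m. if i = 0 then 1 else 0)"
      unfolding p_def coeff_sum by (rule sum.cong) (auto simp: nat_power_eq_Suc_0_iff)
    then show "coeff p 1 \<noteq> 0" using extension_degree_pos by simp
    show "degree p \<le> 2 ^ (m - 1)"
      unfolding p_def
    proof (rule degree_sum_le)
      fix i assume "i \<in> {..<m}"
      then have "i \<le> m - 1" by auto
      then show "degree (monom (1::'a) (2 ^ i)) \<le> 2 ^ (m - 1)"
        by (simp add: degree_monom_eq)
    qed simp
    show "poly p x = 0" for x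
      using zero[of x] by (simp add: p_def poly_sum poly_monom)
  qed
  then show False
    using card extension_degree_pos by (cases m) simp_all
qed

lemma abs_trace_nondegenerate: "(\<forall>x. abs_trace m (x * y) = 0) \<longleftrightarrow> y = (0::'a)"
proof
  assume *: "\<forall>x. abs_trace m (x * y) = 0"
  obtain z :: 'a where "abs_trace m z = 1" using abs_trace_surj by blast
  then show "y = 0" using *[rule_format, of "z / y"] by (cases "y = 0") auto
qed (simp add: abs_trace_0)

lemma sum_sign_trace: "(\<Sum>x\<in>UNIV. bit_sign (abs_trace m (x * y))) = (if y = (0::'a) then 2 ^ m else 0)"
  by (subst sum_bit_sign)
    (use abs_trace_nondegenerate[of y] in \<open>auto simp: distrib_right abs_trace_add card\<close>)

end

lemma frob_mult: "frob j (x * y) = frob j x * frob j y"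
  by (simp add: frob_def power_mult_distrib)

lemma frob_divide: "frob j (x / y) = frob j x / frob j y"
  by (simp add: frob_def power_divide)

lemma frob_frob: "frob i (frob j x) = frob (i + j) x"
  by (simp add: frob_def power_add mult.commute flip: power_mult)

text \<open>Every nonempty fibre of an additive map is a coset of its kernel.\<close>

lemma card_range_additive:
  fixes \<phi> :: "'a::{finite,ab_group_add} \<Rightarrow> 'a"
  assumes add: "\<And>x y. \<phi> (x + y) = \<phi> x + \<phi> y"
  shows "CARD('a) = card (range \<phi>) * card {x. \<phi> x = 0}"
proof -
  have fibre: "card {x. \<phi> x = \<phi> y} = card {x. \<phi> x = 0}" for y
  proof -
    have "{x. \<phi> x = \<phi> y} = (+) y ` {x. \<phi> x = 0}"
    proof
      show "{x. \<phi> x = \<phi> y} \<subseteq> (+) y ` {x. \<phi> x = 0}"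
      proof
        fix x assume "x \<in> {x. \<phi> x = \<phi> y}"
        then have "\<phi> (x - y) = 0" using add[of "x - y" y] by simp
        then show "x \<in> (+) y ` {x. \<phi> x = 0}" by (intro image_eqI[of _ _ "x - y"]) auto
      qed
    qed (auto simp: add)
    then show ?thesis by (simp add: card_image)
  qed
  have "CARD('a) = (\<Sum>z\<in>range \<phi>. card {x. \<phi> x = z})"
    using sum.image_gen[of "UNIV :: 'a set" "\<lambda>_. 1::nat" \<phi>] by simp
  also have "\<dots> = (\<Sum>z\<in>range \<phi>. card {x. \<phi> x = 0})"
    by (rule sum.cong) (auto simp: fibre)
  finally show ?thesis by simp
qed

lemma sum_UNIV_shift: "(\<Sum>x\<in>UNIV. F (a + x)) = (\<Sum>x\<in>UNIV. F (x :: 'a::{finite,ab_group_add}))"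
  by (rule sum.reindex_bij_witness[of _ "\<lambda>x. x - a" "\<lambda>x. a + x"]) auto

section \<open>Quadratic character sums over a cubic extension\<close>

text \<open>
  By additive Hilbert 90 this image is the kernel of the relative trace to the subfield of order
  \<open>2 ^ k\<close>.
\<close>

definition trace_kernel :: "nat \<Rightarrow> 'a::field set" where
  "trace_kernel k = range (\<lambda>a. a + frob k a)"

definition quad_form :: "nat \<Rightarrow> 'a::field \<Rightarrow> 'a \<Rightarrow> 'a \<Rightarrow> bit" where
  "quad_form k c b x = abs_trace (3 * k) (c * (x * frob k x) + b * x)"

definition quad_sum :: "nat \<Rightarrow> 'a::{field,finite} \<Rightarrow> 'a \<Rightarrow> int" where
  "quad_sum k c b = (\<Sum>x\<in>UNIV. bit_sign (quad_form k c b x))"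

text \<open>Replacing \<open>b\<close> by \<open>b + 1\<close> adds the trace of \<open>x\<close> to
  the form. The difference is therefore minus twice the character sum over the elements of trace
  one, which are the coordinates of the code.\<close>

definition quad_diff :: "nat \<Rightarrow> 'a::{field,finite} \<Rightarrow> 'a \<Rightarrow> int" where
  "quad_diff k c b = quad_sum k c (b + 1) - quad_sum k c b"

context
  fixes k :: nat
  assumes card: "CARD('a::finite_field) = 2 ^ (3 * k)"
    and k: "2 \<le> k"
begin

lemma frob_cube: "frob k (frob k (frob k x)) = (x::'a)"
proof -
  have "frob k (frob k (frob k x)) = frob (3 * k) x"
    by (simp add: frob_frob add.assoc[symmetric] flip: mult_2)
  then show ?thesis using finite_field_power_card_eq_same[of x] by (simp add: card frob_def)
qed

text \<open>
  Both polynomial root bounds are attained, because the product of the two cardinalities is that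
  of the field.
\<close>

lemma card_fixed_field: "card {x::'a. frob k x = x} = 2 ^ k"
  and card_trace_kernel: "card (trace_kernel k :: 'a set) = 2 ^ (2 * k)"
proof -
  let ?K = "{x::'a. frob k x = x}" and ?L = "trace_kernel k :: 'a set"
  have k_pos: "(2::nat) ^ k \<noteq> 1" "(2::nat) ^ (2 * k) \<noteq> 1" using k by auto
  have K: "card ?K \<le> 2 ^ k"
  proof (rule card_poly_roots_le[OF card])
    let ?p = "monom 1 (2 ^ k) - monom 1 1 :: 'a poly"
    show "coeff ?p 1 \<noteq> 0" using k_pos by simp
    have "(1::nat) \<le> 2 ^ k" by simp
    then show "degree ?p \<le> 2 ^ k" by (intro degree_diff_le) (simp_all add: degree_monom_eq)
    show "poly ?p x = 0" if "x \<in> ?K" for x using that by (simp add: poly_monom frob_def)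
  qed
  have L: "card ?L \<le> 2 ^ (2 * k)"
  proof (rule card_poly_roots_le[OF card])
    \<comment> \<open>The relative trace to the subfield of order \<open>2 ^ k\<close>; on
      \<open>a + frob k a\<close> the conjugates cancel in pairs.\<close>
    let ?p = "monom 1 1 + monom 1 (2 ^ k) + monom 1 (2 ^ (2 * k)) :: 'a poly"
    show "coeff ?p 1 \<noteq> 0" using k_pos by simp
    have "(1::nat) \<le> 2 ^ (2 * k)" "(2::nat) ^ k \<le> 2 ^ (2 * k)" by simp_all
    then show "degree ?p \<le> 2 ^ (2 * k)" by (intro degree_add_le) (simp_all add: degree_monom_eq)
    show "poly ?p x = 0" if x: "x \<in> ?L" for x
    proof -
      obtain a where a: "x = a + frob k a" using x by (auto simp: trace_kernel_def)
      have "poly ?p x = x + frob k x + frob k (frob k x)"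
        by (simp add: poly_monom frob_frob mult_2) (simp add: frob_def)
      also have "\<dots> = (a + a) + (frob k a + frob k a) + (frob k (frob k a) + frob k (frob k a))"
        unfolding a frob_add[OF card] frob_cube by (simp add: ac_simps)
      finally show ?thesis by (simp add: char_two_add_self[OF card])
    qed
  qed
  have "{x::'a. x + frob k x = 0} = ?K"
    by (auto simp: char_two_add_eq_0_iff[OF card])
  then have "card ?L * card ?K = 2 ^ (2 * k) * 2 ^ k"
    using card_range_additive[of "\<lambda>a::'a. a + frob k a"] card
    by (simp add: trace_kernel_def frob_add[OF card] add.assoc add.left_commute flip: power_add)
  moreover have "card ?L * card ?K \<le> card ?L * 2 ^ k" "card ?L * card ?K \<le> 2 ^ (2 * k) * card ?K"
    using K L by simp_all
  ultimately show "card ?K = 2 ^ k" "card ?L = 2 ^ (2 * k)"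
    using K L by auto
qed

section \<open>Polarization, radical and squares of the character sums\<close>

lemma quad_form_polar:
  "quad_form k c b (x + h) = quad_form k c b x + quad_form k c b h
    + abs_trace (3 * k) (x * (c * frob k h + frob k (frob k (c * h))))" for x :: 'a
proof -
  \<comment> \<open>Two applications of \<open>frob k\<close> leave the trace unchanged and turn
    \<open>frob k x\<close> back into \<open>x\<close>, so both cross terms become multiples of
    \<open>x\<close>.\<close>
  have "abs_trace (3 * k) (c * h * frob k x) = abs_trace (3 * k) (x * frob k (frob k (c * h)))"
    using abs_trace_frob[OF card, of k "frob k (c * h * frob k x)"]
      abs_trace_frob[OF card, of k "c * h * frob k x"]
    by (simp add: frob_mult frob_cube mult.commute)
  moreover have "c * ((x + h) * frob k (x + h)) + b * (x + h)
      = (c * (x * frob k x) + b * x) + (c * (h * frob k h) + b * h) + x * (c * frob k h) + c * h * frob k x"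
    by (simp add: frob_add[OF card] algebra_simps)
  ultimately show ?thesis
    by (simp only: quad_form_def abs_trace_add[OF card] distrib_left add.assoc add.commute add.left_commute)
qed

lemma quad_form_add:
  "quad_form k (c + c') (b + b') x = quad_form k c b x + quad_form k c' b' x" for x :: 'a
  by (simp add: quad_form_def distrib_right abs_trace_add[OF card] add.assoc add.left_commute)

text \<open>Put \<open>y = x + h\<close> in the double sum. By polarization the sum over
  \<open>x\<close> for fixed \<open>h\<close> is that of an additive character, which vanishes
  unless \<open>h\<close> lies in the radical.\<close>

lemma quad_sum_square:
  fixes c b :: 'a
  shows "(quad_sum k c b)\<^sup>2 = 2 ^ (3 * k) *
    (\<Sum>h | c * frob k h + frob k (frob k (c * h)) = 0. bit_sign (quad_form k c b h))"
proof -
  let ?g = "quad_form k c b" and ?M = "\<lambda>h. c * frob k h + frob k (frob k (c * h))"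
  have "(quad_sum k c b)\<^sup>2 = (\<Sum>x\<in>UNIV. \<Sum>y\<in>UNIV. bit_sign (?g x) * bit_sign (?g y))"
    by (simp add: power2_eq_square quad_sum_def sum_product)
  also have "\<dots> = (\<Sum>x\<in>UNIV. \<Sum>h\<in>UNIV. bit_sign (?g x) * bit_sign (?g (x + h)))"
    by (rule sum.cong[OF refl], rule sum_UNIV_shift[symmetric])
  also have "\<dots> = (\<Sum>x\<in>UNIV. \<Sum>h\<in>UNIV. bit_sign (?g h) * bit_sign (abs_trace (3 * k) (x * ?M h)))"
  proof (intro sum.cong refl)
    fix x h
    have "?g x + ?g (x + h) = (?g x + ?g x) + (?g h + abs_trace (3 * k) (x * ?M h))"
      by (simp only: quad_form_polar add.assoc)
    then show "bit_sign (?g x) * bit_sign (?g (x + h))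
        = bit_sign (?g h) * bit_sign (abs_trace (3 * k) (x * ?M h))"
      by (simp only: bit_sign_add[symmetric] bit_add_self add_0)
  qed
  also have "\<dots> = (\<Sum>h\<in>UNIV. \<Sum>x\<in>UNIV. bit_sign (?g h) * bit_sign (abs_trace (3 * k) (x * ?M h)))"
    by (rule sum.swap)
  also have "\<dots> = (\<Sum>h\<in>UNIV. bit_sign (?g h) * (if ?M h = 0 then 2 ^ (3 * k) else 0))"
    by (simp only: sum_distrib_left[symmetric] sum_sign_trace[OF card])
  also have "\<dots> = (\<Sum>h | ?M h = 0. 2 ^ (3 * k) * bit_sign (?g h))"
    by (rule sum.mono_neutral_cong_right) auto
  finally show ?thesis by (simp only: sum_distrib_left)
qed

lemma radical_eq:
  fixes c :: 'a
  assumes c: "c \<noteq> 0"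
  shows "{h. c * frob k h + frob k (frob k (c * h)) = 0} = (\<lambda>l. l * frob k c) ` {l. frob k l = l}"
proof
  have fc: "frob k c \<noteq> 0" "frob k (frob k c) \<noteq> 0" using c by (simp_all add: frob_def)
  show "{h. c * frob k h + frob k (frob k (c * h)) = 0} \<subseteq> (\<lambda>l. l * frob k c) ` {l. frob k l = l}"
  proof
    fix h assume "h \<in> {h. c * frob k h + frob k (frob k (c * h)) = 0}"
    then have h: "c * frob k h = frob k (frob k c) * frob k (frob k h)"
      by (simp add: char_two_add_eq_0_iff[OF card] frob_mult)
    \<comment> \<open>A conjugate of \<open>h\<close>; it eliminates
      \<open>frob k (frob k h)\<close>, after which \<open>c\<close> cancels and
      \<open>h / frob k c\<close> is seen to be fixed by \<open>frob k\<close>.\<close>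
    have h': "frob k c * frob k (frob k h) = c * h"
      using arg_cong[OF h, of "frob k"] by (simp add: frob_mult frob_cube)
    have "c * (frob k h * frob k c) = frob k (frob k c) * (frob k c * frob k (frob k h))"
      using h by (simp add: mult.commute mult.left_commute)
    also have "\<dots> = c * (h * frob k (frob k c))"
      unfolding h' by (simp add: ac_simps)
    finally have "frob k h * frob k c = h * frob k (frob k c)" using c by simp
    then have "frob k (h / frob k c) = h / frob k c"
      using fc by (simp add: frob_divide frac_eq_eq)
    moreover have "h = h / frob k c * frob k c" using fc by simp
    ultimately show "h \<in> (\<lambda>l. l * frob k c) ` {l. frob k l = l}" by blast
  qed
qed (auto simp: frob_mult frob_cube char_two_add_eq_0_iff[OF card] ac_simps)

text \<open>For \<open>c = a + frob k a\<close> and \<open>l\<close> in the subfield, the argument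
  has the form \<open>y + frob k y\<close> with \<open>y = l * frob k a\<close>, and the two traces
  cancel.\<close>

lemma abs_trace_radical:
  fixes c l :: 'a
  assumes c: "c \<in> trace_kernel k" and l: "frob k l = l"
  shows "abs_trace (3 * k) (l * frob k c) = 0"
proof -
  obtain a where a: "c = a + frob k a" using c by (auto simp: trace_kernel_def)
  have "l * frob k c = l * frob k a + frob k (l * frob k a)"
    by (simp add: a l frob_add[OF card] frob_mult distrib_left)
  then show ?thesis by (simp add: abs_trace_add[OF card] abs_trace_frob[OF card])
qed

text \<open>The form is additive on the radical, which has \<open>2 ^ k\<close> elements, so the sum
  over it is \<open>0\<close> or \<open>2 ^ k\<close>. Passing from \<open>b\<close> to
  \<open>b + 1\<close> adds the trace, which vanishes on the radical.\<close>

lemma quad_sum_square_cases: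
  fixes c b :: 'a
  assumes c: "c \<in> trace_kernel k" "c \<noteq> 0"
  shows "(quad_sum k c b)\<^sup>2 \<in> {0, (2 ^ (2 * k))\<^sup>2}"
    and "(quad_sum k c (b + 1))\<^sup>2 = (quad_sum k c b)\<^sup>2"
proof -
  let ?R = "{h. c * frob k h + frob k (frob k (c * h)) = 0}"
  have "frob k c \<noteq> 0" using c by (simp add: frob_def)
  then have "card ?R = 2 ^ k"
    unfolding radical_eq[OF c(2)] using card_fixed_field by (subst card_image) (auto simp: inj_on_def)
  moreover have "(\<Sum>h\<in>?R. bit_sign (quad_form k c b h))
      = (if \<forall>h\<in>?R. quad_form k c b h = 0 then int (card ?R) else 0)"
  proof (rule sum_bit_sign)
    fix h h' assume h: "h \<in> ?R" "h' \<in> ?R"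
    have "c * frob k (h + h') + frob k (frob k (c * (h + h')))
      = (c * frob k h + frob k (frob k (c * h))) + (c * frob k h' + frob k (frob k (c * h')))"
      by (simp add: distrib_left frob_add[OF card] ac_simps)
    then show "h + h' \<in> ?R" using h by simp
    show "quad_form k c b (h + h') = quad_form k c b h + quad_form k c b h'"
      using h by (simp add: quad_form_polar abs_trace_0[OF card])
  qed simp
  ultimately show "(quad_sum k c b)\<^sup>2 \<in> {0, (2 ^ (2 * k))\<^sup>2}"
    unfolding quad_sum_square by (auto simp flip: power_add power_mult)
  have "quad_form k c (b + 1) h = quad_form k c b h" if "h \<in> ?R" for h
    using that quad_form_add[of c 0 b 1 h] abs_trace_radical[OF c(1)] unfolding radical_eq[OF c(2)]
    by (auto simp: quad_form_def)
  then show "(quad_sum k c (b + 1))\<^sup>2 = (quad_sum k c b)\<^sup>2"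
    unfolding quad_sum_square by simp
qed

text \<open>Equal squares make the two sums equal or opposite, so the difference is \<open>0\<close>
  or \<open>- 2 * quad_sum k c b\<close>.\<close>

lemma quad_diff_cases:
  fixes c b :: 'a
  assumes c: "c \<in> trace_kernel k" "c \<noteq> 0"
  shows "quad_diff k c b \<in> {0, 2 * 2 ^ (2 * k), - (2 * 2 ^ (2 * k))}"
proof -
  have "quad_sum k c b \<in> {0, 2 ^ (2 * k), - (2 ^ (2 * k))}"
    using quad_sum_square_cases(1)[OF c, of b] unfolding insert_iff power2_eq_iff by auto
  moreover have "quad_sum k c (b + 1) = quad_sum k c b \<or> quad_sum k c (b + 1) = - quad_sum k c b"
    using quad_sum_square_cases(2)[OF c, of b] by (simp add: power2_eq_iff)
  ultimately show ?thesis by (auto simp: quad_diff_def)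
qed

section \<open>Symmetry, second moment and value frequencies\<close>

lemma quad_diff_shift: "quad_diff k c (1 + b) = - quad_diff k c b" for b :: 'a
proof -
  have "1 + b + 1 = b" using char_two_add_self[OF card, of 1] by (simp add: algebra_simps)
  then show ?thesis by (simp add: quad_diff_def add.commute)
qed

text \<open>Autocorrelation in \<open>b\<close>: summing over \<open>b\<close> first forces
  \<open>x = y\<close>, and what remains is the character sum of \<open>x * e\<close>. The case
  \<open>e = 0\<close> is Parseval's identity.\<close>

lemma sum_quad_sum_mult:
  fixes c e :: 'a
  shows "(\<Sum>b\<in>UNIV. quad_sum k c b * quad_sum k c (b + e)) = (if e = 0 then 2 ^ (6 * k) else 0)"
proof -
  let ?t = "abs_trace (3 * k)" and ?q = "\<lambda>x. quad_form k c 0 x"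
  have prod: "bit_sign (quad_form k c b x) * bit_sign (quad_form k c (b + e) y)
      = bit_sign (?q x + ?q y + ?t (y * e)) * bit_sign (?t (b * (x + y)))" for b x y
  proof -
    have "quad_form k c b x + quad_form k c (b + e) y = ?q x + ?q y + ?t (y * e) + ?t (b * (x + y))"
      by (simp add: quad_form_def abs_trace_add[OF card] distrib_left distrib_right mult.commute[of e]
        add.assoc add.commute add.left_commute)
    then show ?thesis by (simp only: bit_sign_add[symmetric])
  qed
  have "(\<Sum>b\<in>UNIV. quad_sum k c b * quad_sum k c (b + e))
      = (\<Sum>b\<in>UNIV. \<Sum>x\<in>UNIV. \<Sum>y\<in>UNIV. bit_sign (?q x + ?q y + ?t (y * e)) * bit_sign (?t (b * (x + y))))"
    by (simp only: quad_sum_def sum_product prod)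
  also have "\<dots> = (\<Sum>x\<in>UNIV. \<Sum>b\<in>UNIV. \<Sum>y\<in>UNIV. bit_sign (?q x + ?q y + ?t (y * e)) * bit_sign (?t (b * (x + y))))"
    by (rule sum.swap)
  also have "\<dots> = (\<Sum>x\<in>UNIV. \<Sum>y\<in>UNIV. \<Sum>b\<in>UNIV. bit_sign (?q x + ?q y + ?t (y * e)) * bit_sign (?t (b * (x + y))))"
    by (rule sum.cong[OF refl], rule sum.swap)
  also have "\<dots> = (\<Sum>x\<in>UNIV. \<Sum>y\<in>UNIV. if y = x then bit_sign (?t (x * e)) * 2 ^ (3 * k) else 0)"
    unfolding sum_distrib_left[symmetric] sum_sign_trace[OF card] char_two_add_eq_0_iff[OF card]
    by (intro sum.cong refl) auto
  also have "\<dots> = (\<Sum>x\<in>UNIV. bit_sign (?t (x * e))) * 2 ^ (3 * k)"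
    by (simp add: sum_distrib_right)
  also have "\<dots> = (if e = 0 then 2 ^ (6 * k) else 0)"
    unfolding sum_sign_trace[OF card] by (simp flip: power_add)
  finally show ?thesis .
qed

lemma sum_quad_diff_square: "(\<Sum>b\<in>UNIV. (quad_diff k c b)\<^sup>2) = 2 * 2 ^ (6 * k)" for c :: 'a
proof -
  have sq: "(\<Sum>b\<in>UNIV. (quad_sum k c b)\<^sup>2) = 2 ^ (6 * k)"
    using sum_quad_sum_mult[of c 0] by (simp add: power2_eq_square)
  moreover have "(\<Sum>b\<in>UNIV. (quad_sum k c (b + 1))\<^sup>2) = 2 ^ (6 * k)"
    using sum_UNIV_shift[of "\<lambda>b. (quad_sum k c b)\<^sup>2" 1] sq by (simp add: add.commute)
  moreover have "(\<Sum>b\<in>UNIV. quad_sum k c b * quad_sum k c (b + 1)) = 0"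
    using sum_quad_sum_mult[of c 1] by simp
  moreover have "(quad_diff k c b)\<^sup>2 = (quad_sum k c (b + 1))\<^sup>2 + (quad_sum k c b)\<^sup>2
      - 2 * (quad_sum k c b * quad_sum k c (b + 1))" for b
    by (simp add: quad_diff_def power2_eq_square algebra_simps)
  ultimately show ?thesis
    by (simp add: sum.distrib sum_subtractf flip: sum_distrib_left)
qed

text \<open>With \<open>Q = 2 ^ (2 * k)\<close> the second moment reads
  \<open>4 * Q\<^sup>2 * (P + N) = 2 * Q ^ 3\<close>, where \<open>P\<close> and \<open>N\<close>
  count the positive and negative values. The symmetry gives \<open>P = N\<close>, hence
  \<open>4 * P = Q\<close>; the zeros are the complement.\<close>

lemma card_quad_diff:
  fixes c :: 'a
  assumes c: "c \<in> trace_kernel k" "c \<noteq> 0"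
  shows "4 * card {b. quad_diff k c b = 2 * 2 ^ (2 * k)} = 2 ^ (2 * k)"
    and "4 * card {b. quad_diff k c b = - (2 * 2 ^ (2 * k))} = 2 ^ (2 * k)"
    and "card {b. quad_diff k c b = 0} + 2 ^ (2 * k - 1) = 2 ^ (3 * k)"
proof -
  define Q :: int where "Q = 2 ^ (2 * k)"
  have Q: "Q > 0" by (simp add: Q_def)
  let ?P = "{b. quad_diff k c b = 2 * Q}" and ?N = "{b. quad_diff k c b = - (2 * Q)}"
    and ?Z = "{b. quad_diff k c b = 0}"
  have "bij_betw ((+) 1) ?P ?N"
    by (rule bij_betwI[where g = "(+) 1"])
      (auto simp: quad_diff_shift add.assoc[symmetric] char_two_add_self[OF card])
  then have PN: "card ?P = card ?N" by (rule bij_betw_same_card)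
  have cases: "quad_diff k c b = 0 \<or> quad_diff k c b = 2 * Q \<or> quad_diff k c b = - (2 * Q)" for b
    using quad_diff_cases[OF c, of b] by (simp add: Q_def)
  have "(quad_diff k c b)\<^sup>2 = 4 * Q\<^sup>2 * (of_bool (b \<in> ?P) + of_bool (b \<in> ?N))" for b
    using cases[of b] Q by (auto simp: power2_eq_square)
  then have "2 * 2 ^ (6 * k) = (\<Sum>b\<in>UNIV. 4 * Q\<^sup>2 * (of_bool (b \<in> ?P) + of_bool (b \<in> ?N)))"
    using sum_quad_diff_square[of c] by simp
  also have "\<dots> = 4 * Q\<^sup>2 * (int (card ?P) + int (card ?N))"
    unfolding sum_distrib_left[symmetric] sum.distrib by (simp add: sum_of_bool_eq)
  finally have "Q\<^sup>2 * (2 * Q) = Q\<^sup>2 * (4 * (int (card ?P) + int (card ?N)))"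
    by (simp add: Q_def algebra_simps flip: power_add power_mult)
  then have PQ: "4 * int (card ?P) = Q" using Q PN by simp
  then have "int (4 * card ?P) = int (2 ^ (2 * k))" by (simp add: Q_def)
  then show P: "4 * card {b. quad_diff k c b = 2 * 2 ^ (2 * k)} = 2 ^ (2 * k)"
    unfolding of_nat_eq_iff by (simp add: Q_def)
  then show "4 * card {b. quad_diff k c b = - (2 * 2 ^ (2 * k))} = 2 ^ (2 * k)"
    using PN by (simp add: Q_def)
  have "UNIV = ?Z \<union> (?P \<union> ?N)" using cases by auto
  then have "CARD('a) = card (?Z \<union> (?P \<union> ?N))" by metis
  also have "\<dots> = card ?Z + (card ?P + card ?N)"
    using Q by (subst card_Un_disjoint, simp, simp, force)+ simp
  finally have "card ?Z + 2 * card ?P = 2 ^ (3 * k)" using PN card by simp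
  moreover have "4 * card ?P = 2 * 2 ^ (2 * k - 1)"
    using P k by (simp add: Q_def flip: power_Suc)
  ultimately show "card {b. quad_diff k c b = 0} + 2 ^ (2 * k - 1) = 2 ^ (3 * k)" by linarith
qed

text \<open>For \<open>c = 0\<close> the form is linear, so \<open>quad_sum\<close> lives at
  \<open>b = 0\<close> alone. The two exceptional arguments belong to the zero word
  (\<open>b = 0\<close>) and the all-one word (\<open>b = 1\<close>).\<close>

lemma quad_diff_0:
  "quad_diff k 0 b = (if b = 1 then 2 ^ (3 * k) else if b = 0 then - (2 ^ (3 * k)) else 0)" for b :: 'a
proof -
  have "quad_sum k 0 b = (if b = 0 then 2 ^ (3 * k) else 0)" for b :: 'a
    using sum_sign_trace[OF card, of b] by (simp add: quad_sum_def quad_form_def mult.commute)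
  then show ?thesis by (auto simp: quad_diff_def char_two_add_eq_0_iff[OF card])
qed

end

section \<open>The code and its dual\<close>

definition trace_one :: "nat \<Rightarrow> 'a::field set" where
  "trace_one k = {x. x \<noteq> 0 \<and> abs_trace (3 * k) x = 1}"

definition code_word :: "nat \<Rightarrow> 'a::field \<Rightarrow> 'a \<Rightarrow> 'a \<Rightarrow> bit" where
  "code_word k c b = (\<lambda>x. if x \<in> trace_one k then quad_form k c b x else 0)"

text \<open>Normal form of the punctured code, common to all admissible exponents. Unlike the
  original coefficient \<open>a\<close>, the parameter \<open>c\<close> is determined by the
  codeword, see \<open>inj_code_word\<close>.\<close>

definition trace_code :: "nat \<Rightarrow> ('a::field \<Rightarrow> bit) set" where
  "trace_code k = {code_word k c b | c b. c \<in> trace_kernel k}"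

lemma two_power_eq_4_mult: "2 \<le> n \<Longrightarrow> (2::'a::comm_semiring_1) ^ n = 4 * 2 ^ (n - 2)"
  by (auto simp: power_add dest!: le_Suc_ex)

text \<open>Makes the dimension of the dual a genuine, positive difference of naturals.\<close>

lemma code_length_bound: "5 * k < 2 ^ (3 * k - 1)" if "3 \<le> k"
proof -
  have "3 * k - 1 = 3 + (3 * k - 4)" using that by simp
  then have "(2::nat) ^ (3 * k - 1) = 8 * 2 ^ (3 * k - 4)" by (simp only: power_add) simp
  moreover have "3 * k - 4 < 2 ^ (3 * k - 4)" by (rule less_exp)
  ultimately show ?thesis using that by linarith
qed

text \<open>For \<open>d \<ge> 5\<close> radius \<open>2\<close> gives
  \<open>1 + n + (n choose 2) \<le> 2 ^ (5 * k)\<close>, whereas twice the left side exceeds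
  \<open>n * n\<close>. The index set is arbitrary because the bound serves both the dual and its
  competitors.\<close>

lemma min_dist_le_4:
  assumes code: "binary_code I C (2 ^ (3 * k - 1)) (2 ^ (3 * k - 1) - 5 * k) d" and k: "3 \<le> k"
  shows "d \<le> 4"
proof (rule ccontr)
  define n :: nat where "n = 2 ^ (3 * k - 1)"
  assume "\<not> d \<le> 4"
  then have "2 ^ (n - 5 * k) * (\<Sum>i\<le>2. n choose i) \<le> 2 ^ n"
    by (intro sphere_packing[OF code[folded n_def]]) simp
  moreover have "n - 5 * k + 5 * k = n"
    using code_length_bound[OF k] by (simp add: n_def)
  then have "(2::nat) ^ n = 2 ^ (n - 5 * k) * 2 ^ (5 * k)"
    by (simp flip: power_add)
  ultimately have "(\<Sum>i\<le>2. n choose i) \<le> 2 ^ (5 * k)" by simp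
  then have "1 + n + (n choose 2) \<le> 2 ^ (5 * k)"
    by (simp add: numeral_2_eq_2)
  moreover have "even (n * (n - 1))"
    by (cases "even n") simp_all
  then have "2 * (n choose 2) = n * (n - 1)"
    unfolding choose_two by (rule dvd_mult_div_cancel)
  moreover have "n * n = n * (n - 1) + n"
    by (cases n) simp_all
  moreover have "2 * 2 ^ (5 * k) \<le> n * n"
  proof -
    have "(2::nat) * 2 ^ (5 * k) = 2 ^ (5 * k + 1)" by simp
    \<comment> \<open>The comparison \<open>5 * k + 1 \<le> 6 * k - 2\<close> is exactly
      \<open>k \<ge> 3\<close>.\<close>
    also have "\<dots> \<le> 2 ^ ((3 * k - 1) + (3 * k - 1))" using k by (intro power_increasing) auto
    also have "\<dots> = n * n" by (simp only: power_add n_def)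
    finally show ?thesis .
  qed
  ultimately show False by linarith
qed

lemma abs_trace_sum:
  assumes "CARD('a::finite_field) = 2 ^ m"
  shows "abs_trace m (\<Sum>x\<in>S. F x) = (\<Sum>x\<in>S. abs_trace m (F x :: 'a))"
  by (induction S rule: infinite_finite_induct) (simp_all add: abs_trace_0[OF assms] abs_trace_add[OF assms])

context
  fixes k :: nat
  assumes card: "CARD('a::finite_field) = 2 ^ (3 * k)"
    and k: "2 \<le> k"
begin

section \<open>Reduction of the exponents to one normal form\<close>

lemma trace_kernel_eq_range:
  assumes "surj g"
  shows "range (\<lambda>a. g a + frob k (g a)) = (trace_kernel k :: 'a set)"
  using image_image[of "\<lambda>a. a + frob k a" g UNIV] assms by (simp add: trace_kernel_def)

lemma surj_frob: "surj (frob k :: 'a \<Rightarrow> 'a)" "surj (\<lambda>a::'a. frob k (frob k a))"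
  by (rule surjI[of _ "\<lambda>x. frob k (frob k x)"], rule frob_cube[OF card k])
    (rule surjI[of _ "frob k"], rule frob_cube[OF card k])

text \<open>The three powers are the conjugates of \<open>x * frob k x\<close>. Frobenius invariance
  of the trace moves the automorphisms onto \<open>a\<close>; two distinct conjugates of
  \<open>a\<close> result, and one of them is \<open>frob k\<close> of the other.\<close>

lemma ex_trace_kernel_param:
  fixes f :: "'a \<Rightarrow> 'a"
  assumes t1: "t1 \<in> {2 ^ k + 1, 2 ^ (2 * k) + 1, 2 ^ (2 * k) + 2 ^ k}"
    and t2: "t2 \<in> {2 ^ k + 1, 2 ^ (2 * k) + 1, 2 ^ (2 * k) + 2 ^ k}"
    and neq: "t1 \<noteq> t2"
    and f: "f = (\<lambda>x. x ^ t1 + x ^ t2)"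
  shows "\<exists>\<phi>. range \<phi> = trace_kernel k \<and>
    (\<forall>a x. abs_trace (3 * k) (a * f x) = abs_trace (3 * k) (\<phi> a * (x * frob k x)))"
proof -
  let ?t = "abs_trace (3 * k) :: 'a \<Rightarrow> bit" and ?s = "frob k :: 'a \<Rightarrow> 'a"
  have pow: "x ^ (2 ^ k + 1) = x * ?s x" "x ^ (2 ^ (2 * k) + 1) = ?s (?s (x * ?s x))"
    "x ^ (2 ^ (2 * k) + 2 ^ k) = ?s (x * ?s x)" for x
  proof -
    have "x ^ 2 ^ (2 * k) = ?s (?s x)" by (simp add: frob_frob mult_2) (simp add: frob_def)
    then show "x ^ (2 ^ k + 1) = x * ?s x" "x ^ (2 ^ (2 * k) + 1) = ?s (?s (x * ?s x))"
      "x ^ (2 ^ (2 * k) + 2 ^ k) = ?s (x * ?s x)"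
      by (simp_all add: power_add frob_mult frob_cube[OF card k] mult.commute) (simp_all add: frob_def mult.commute)
  qed
  have tr1: "?t (a * ?s u) = ?t (?s (?s a) * u)" for a u
    using abs_trace_frob[OF card, of k "?s (a * ?s u)"] abs_trace_frob[OF card, of k "a * ?s u"]
    by (simp add: frob_mult frob_cube[OF card k])
  have tr2: "?t (a * ?s (?s u)) = ?t (?s a * u)" for a u
    using abs_trace_frob[OF card, of k "a * ?s (?s u)"] by (simp add: frob_mult frob_cube[OF card k])
  consider "f = (\<lambda>x. x * ?s x + ?s (x * ?s x))" | "f = (\<lambda>x. x * ?s x + ?s (?s (x * ?s x)))"
    | "f = (\<lambda>x. ?s (x * ?s x) + ?s (?s (x * ?s x)))"
    using assms unfolding f insert_iff empty_iff
    by (elim disjE; simp only: pow; simp add: add.commute)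
  then show ?thesis
  proof cases
    case 1
    \<comment> \<open>The coefficient is \<open>a + ?s (?s a)\<close>; writing \<open>a\<close> as
      its threefold image under \<open>?s\<close> exhibits the form \<open>y + ?s y\<close> with
      \<open>y = ?s (?s a)\<close>.\<close>
    have "range (\<lambda>a. ?s (?s a) + ?s (?s (?s a))) = trace_kernel k"
      by (rule trace_kernel_eq_range) (rule surj_frob)
    then show ?thesis unfolding 1
      by (intro exI[of _ "\<lambda>a. ?s (?s a) + ?s (?s (?s a))"])
        (simp add: frob_cube[OF card k] distrib_left distrib_right abs_trace_add[OF card] tr1 add.commute)
  next
    case 2
    have "range (\<lambda>a. a + ?s a) = trace_kernel k"
      by (simp add: trace_kernel_def)
    then show ?thesis unfolding 2
      by (intro exI[of _ "\<lambda>a. a + ?s a"])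
        (simp add: distrib_left distrib_right abs_trace_add[OF card] tr2)
  next
    case 3
    have "range (\<lambda>a. ?s a + ?s (?s a)) = trace_kernel k"
      by (rule trace_kernel_eq_range) (rule surj_frob)
    then show ?thesis unfolding 3
      by (intro exI[of _ "\<lambda>a. ?s a + ?s (?s a)"])
        (simp add: distrib_left distrib_right abs_trace_add[OF card] tr1 tr2 frob_cube[OF card k] add.commute)
  qed
qed

lemma punctured_code_eq:
  fixes \<phi> f :: "'a \<Rightarrow> 'a"
  assumes range: "range \<phi> = trace_kernel k"
    and tr: "\<And>a x. abs_trace (3 * k) (a * f x) = abs_trace (3 * k) (\<phi> a * (x * frob k x))"
  shows "punctured_code (3 * k) f (trace_one k) = trace_code k"
proof -
  have "(\<lambda>x. if x \<in> trace_one k then abs_trace (3 * k) (a * f x + b * x) else 0)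
      = code_word k (\<phi> a) b" for a b
    by (rule ext) (simp add: code_word_def quad_form_def abs_trace_add[OF card] tr)
  then have "punctured_code (3 * k) f (trace_one k) = {code_word k (\<phi> a) b | a b. True}"
    by (simp add: punctured_code_def)
  also have "\<dots> = trace_code k"
    unfolding trace_code_def range[symmetric] by blast
  finally show ?thesis .
qed

section \<open>Length, weights and dimension of the code\<close>

lemma trace_one_iff: "x \<in> trace_one k \<longleftrightarrow> abs_trace (3 * k) x = 1" for x :: 'a
  using abs_trace_0[OF card] by (auto simp: trace_one_def)

lemma card_trace_one: "card (trace_one k :: 'a set) = 2 ^ (3 * k - 1)"
proof -
  have "(1 - bit_sign (abs_trace (3 * k) x)) = 2 * of_bool (x \<in> trace_one k)" for x :: 'a
    by (cases "abs_trace (3 * k) x") (simp_all add: trace_one_iff)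
  then have "2 * int (card (trace_one k :: 'a set)) = (\<Sum>x::'a\<in>UNIV. 1 - bit_sign (abs_trace (3 * k) x))"
    by (simp add: sum_of_bool_eq flip: sum_distrib_left)
  also have "\<dots> = 2 ^ (3 * k)"
    using sum_sign_trace[OF card, of 1] by (simp add: sum_subtractf card)
  also have "\<dots> = 2 * 2 ^ (3 * k - 1)"
    using k by (simp flip: power_Suc)
  finally have "int (card (trace_one k :: 'a set)) = int (2 ^ (3 * k - 1))" by simp
  then show ?thesis by (simp only: of_nat_eq_iff)
qed

text \<open>Four times the indicator of a nonzero coordinate is the product of
  \<open>1 - bit_sign\<close> of the trace and \<open>1 - bit_sign\<close> of the form. On expansion
  the trace term sums to zero and the product of the signs gives
  \<open>quad_sum k c (b + 1)\<close>.\<close>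

lemma hamming_weight_code_word:
  "4 * int (hamming_weight (trace_one k) (code_word k c b)) = 2 ^ (3 * k) + quad_diff k c b"
  for c b :: 'a
proof -
  let ?t = "abs_trace (3 * k) :: 'a \<Rightarrow> bit" and ?g = "quad_form k c b"
  have g1: "quad_form k c (b + 1) x = ?t x + ?g x" for x
    using quad_form_add[OF card k, of c 0 b 1 x] by (simp add: quad_form_def add.commute)
  have "4 * of_bool (x \<in> trace_one k \<and> code_word k c b x \<noteq> 0)
      = 1 - bit_sign (?t x) - bit_sign (?g x) + bit_sign (quad_form k c (b + 1) x)" for x
    unfolding g1 bit_sign_add
    by (cases "?t x"; cases "?g x") (simp_all add: code_word_def trace_one_iff)
  then have "(\<Sum>x\<in>UNIV. 4 * of_bool (x \<in> trace_one k \<and> code_word k c b x \<noteq> 0))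
      = (\<Sum>x\<in>UNIV. 1 - bit_sign (?t x) - bit_sign (?g x) + bit_sign (quad_form k c (b + 1) x))"
    by simp
  also have "\<dots> = 2 ^ (3 * k) + quad_diff k c b"
    using sum_sign_trace[OF card, of 1]
    by (simp add: sum_subtractf sum.distrib card quad_diff_def quad_sum_def)
  finally show ?thesis
    unfolding hamming_weight_def sum_distrib_left[symmetric]
    by (simp add: sum_of_bool_eq)
qed

lemma code_word_add: "code_word k c b + code_word k c' b' = code_word k (c + c') (b + b')" for c b :: 'a
  by (simp add: code_word_def fun_eq_iff quad_form_add[OF card k])

lemma code_word_0: "code_word k (0::'a) 0 = 0"
  by (simp add: code_word_def fun_eq_iff quad_form_def abs_trace_0[OF card])

lemma trace_kernel_add: "c \<in> trace_kernel k \<Longrightarrow> c' \<in> trace_kernel k \<Longrightarrow> c + c' \<in> (trace_kernel k :: 'a set)"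
proof -
  have "(a + frob k a) + (a' + frob k a') = (a + a') + frob k (a + a')" for a a' :: 'a
    by (simp add: frob_add[OF card] ac_simps)
  then show "c \<in> trace_kernel k \<Longrightarrow> c' \<in> trace_kernel k \<Longrightarrow> c + c' \<in> (trace_kernel k :: 'a set)"
    unfolding trace_kernel_def by (metis (no_types, lifting) rangeE rangeI)
qed

lemma zero_in_trace_kernel: "(0::'a) \<in> trace_kernel k"
  unfolding trace_kernel_def by (rule range_eqI[of _ _ 0]) (simp add: frob_def)

text \<open>In terms of weights, nonzero parameters give a nonzero word; injectivity of the
  parametrization rests on this.\<close>

lemma quad_diff_gt:
  fixes c b :: 'a
  assumes c: "c \<in> trace_kernel k" and nz: "(c, b) \<noteq> (0, 0)"
  shows "- (2 ^ (3 * k)) < quad_diff k c b"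
proof (cases "c = 0")
  case True
  have "- (2 ^ (3 * k)) < (0::int)" by simp
  with True nz show ?thesis
    by (auto simp: quad_diff_0[OF card k])
next
  case False
  have "(2::int) ^ (2 * k + 1) < 2 ^ (3 * k)" using k by (intro power_strict_increasing) auto
  moreover have "- (2 * 2 ^ (2 * k)) \<le> quad_diff k c b"
    using quad_diff_cases[OF card k c False, of b] by auto
  ultimately show ?thesis by simp
qed

lemma inj_code_word: "inj_on (\<lambda>(c, b). code_word k c b) (trace_kernel k \<times> (UNIV :: 'a set))"
proof (rule inj_onI, clarify)
  fix c b c' b' :: 'a
  assume c: "c \<in> trace_kernel k" "c' \<in> trace_kernel k" and eq: "code_word k c b = code_word k c' b'"
  have "code_word k (c + c') (b + b') = 0"
    unfolding code_word_add[symmetric] eq by (simp add: fun_eq_iff)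
  then have "quad_diff k (c + c') (b + b') = - (2 ^ (3 * k))"
    using hamming_weight_code_word[of "c + c'" "b + b'"] by (simp add: hamming_weight_def)
  then have "(c + c', b + b') = (0, 0)"
    using quad_diff_gt[OF trace_kernel_add[OF c], of "b + b'"] by auto
  then show "c = c' \<and> b = b'" by (simp add: char_two_add_eq_0_iff[OF card])
qed

lemma trace_code_eq_image: "trace_code k = (\<lambda>(c, b). code_word k c b) ` (trace_kernel k \<times> (UNIV :: 'a set))"
  unfolding trace_code_def by auto

lemma trace_code_subset: "trace_code k \<subseteq> words (trace_one k :: 'a set)"
  by (auto simp: trace_code_def words_def code_word_def)

lemma subspace_trace_code: "word.subspace (trace_code k :: ('a \<Rightarrow> bit) set)"
proof (rule word.subspaceI)
  show zero: "0 \<in> (trace_code k :: ('a \<Rightarrow> bit) set)"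
    using code_word_0 zero_in_trace_kernel unfolding trace_code_def by fastforce
  show "v + v' \<in> trace_code k" if "v \<in> trace_code k" "v' \<in> trace_code k" for v v' :: "'a \<Rightarrow> bit"
    using that trace_kernel_add unfolding trace_code_def by (force simp: code_word_add)
  show "scale_word c v \<in> trace_code k" if "v \<in> trace_code k" for c and v :: "'a \<Rightarrow> bit"
    using that zero by (cases c) (simp_all add: scale_word_def zero_fun_def)
qed

lemma dim_trace_code: "word.dim (trace_code k :: ('a \<Rightarrow> bit) set) = 5 * k"
proof (rule dim_of_card)
  show "finite (trace_code k :: ('a \<Rightarrow> bit) set)"
    by (simp add: trace_code_eq_image)
  show "card (trace_code k :: ('a \<Rightarrow> bit) set) = 2 ^ (5 * k)"
    unfolding trace_code_eq_image card_image[OF inj_code_word]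
    by (simp add: card_trace_kernel[OF card k] card flip: power_add)
qed (rule subspace_trace_code)

section \<open>Weight distribution and minimum distance\<close>

lemma weight_multiplicity_trace_code:
  assumes v: "4 * int w = 2 ^ (3 * k) + v"
  shows "weight_multiplicity (trace_one k :: 'a set) (trace_code k) w
    = card {b::'a. quad_diff k 0 b = v}
      + (\<Sum>c\<in>trace_kernel k - {0}. card {b::'a. quad_diff k c b = v})"
proof -
  let ?L = "trace_kernel k :: 'a set"
  have weight: "hamming_weight (trace_one k) (code_word k c b) = w \<longleftrightarrow> quad_diff k c b = v" for c b :: 'a
    using hamming_weight_code_word[of c b] v by linarith
  have "{u \<in> trace_code k. hamming_weight (trace_one k :: 'a set) u = w}
      = (\<lambda>(c, b). code_word k c b) ` Sigma ?L (\<lambda>c. {b. quad_diff k c b = v})"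
    using weight by (auto simp: trace_code_eq_image)
  then have "weight_multiplicity (trace_one k :: 'a set) (trace_code k) w
      = card (Sigma ?L (\<lambda>c. {b. quad_diff k c b = v}))"
    unfolding weight_multiplicity_def
    by (simp add: card_image[OF inj_on_subset[OF inj_code_word]] Sigma_mono)
  also have "\<dots> = (\<Sum>c\<in>?L. card {b. quad_diff k c b = v})"
    by simp
  also have "\<dots> = card {b::'a. quad_diff k 0 b = v} + (\<Sum>c\<in>?L - {0}. card {b. quad_diff k c b = v})"
    by (rule sum.remove) (simp_all add: zero_in_trace_kernel)
  finally show ?thesis .
qed

lemma card_trace_kernel_nonzero: "int (card (trace_kernel k - {0::'a})) = 2 ^ (2 * k) - 1"
  using zero_in_trace_kernel card_trace_kernel[OF card k] by (simp add: card_Diff_singleton of_nat_diff)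

lemma power_bounds: "0 < (2::int) ^ (2 * k)" "2 * (2::int) ^ (2 * k) < 2 ^ (3 * k)"
proof -
  have "(2::int) ^ (2 * k + 1) < 2 ^ (3 * k)" using k by (intro power_strict_increasing) auto
  then show "2 * (2::int) ^ (2 * k) < 2 ^ (3 * k)" by simp
qed simp

lemma weight_multiplicity_extreme:
  assumes "4 * int w = 2 ^ (3 * k) + v" "v = 2 ^ (3 * k) \<or> v = - (2 ^ (3 * k))"
  shows "weight_multiplicity (trace_one k :: 'a set) (trace_code k) w = 1"
proof -
  \<comment> \<open>The all-one word and the zero word; for \<open>c \<noteq> 0\<close> the values
    are too small in modulus to interfere.\<close>
  have "{b::'a. quad_diff k 0 b = v} = {if v = 2 ^ (3 * k) then 1 else 0}"
    using assms(2) power_bounds by (auto simp: quad_diff_0[OF card k])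
  moreover have "quad_diff k c b \<noteq> v" if "c \<in> trace_kernel k - {0}" for c b :: 'a
    using quad_diff_cases[OF card k, of c b] that assms(2) power_bounds
    unfolding insert_iff empty_iff Diff_iff by linarith
  ultimately show ?thesis using weight_multiplicity_trace_code[OF assms(1)] by simp
qed

lemma weight_multiplicity_side:
  assumes "4 * int w = 2 ^ (3 * k) + v" "v = 2 * 2 ^ (2 * k) \<or> v = - (2 * 2 ^ (2 * k))"
  shows "int (weight_multiplicity (trace_one k :: 'a set) (trace_code k) w)
    = 2 ^ (4 * k - 2) - 2 ^ (2 * k - 2)"
proof -
  have "quad_diff k 0 b \<noteq> v" for b :: 'a
    using assms(2) power_bounds unfolding quad_diff_0[OF card k] by (smt (verit))
  moreover have "card {b::'a. quad_diff k c b = v} = 2 ^ (2 * k - 2)" if "c \<in> trace_kernel k - {0}" for c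
  proof -
    have "(2::nat) ^ (2 * k) = 4 * 2 ^ (2 * k - 2)"
      using k by (intro two_power_eq_4_mult) simp
    then show ?thesis using card_quad_diff(1,2)[OF card k, of c] that assms(2) by auto
  qed
  ultimately have "int (weight_multiplicity (trace_one k :: 'a set) (trace_code k) w)
      = (2 ^ (2 * k) - 1) * 2 ^ (2 * k - 2)"
    using weight_multiplicity_trace_code[OF assms(1)] by (simp add: card_trace_kernel_nonzero)
  moreover have "2 * k + (2 * k - 2) = 4 * k - 2" using k by simp
  ultimately show ?thesis by (simp add: left_diff_distrib flip: power_add)
qed

lemma weight_multiplicity_middle:
  assumes "4 * int w = 2 ^ (3 * k)"
  shows "int (weight_multiplicity (trace_one k :: 'a set) (trace_code k) w)
    = 2 ^ (5 * k) - 2 ^ (4 * k - 1) + 2 ^ (2 * k - 1) - 2"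
proof -
  have "{b::'a. quad_diff k 0 b = 0} = UNIV - {0, 1}"
    by (auto simp: quad_diff_0[OF card k])
  moreover have "card (UNIV - {0, 1} :: 'a set) + card {0, 1 :: 'a} = CARD('a)"
    by (metis card_Diff_subset card_mono finite le_add_diff_inverse2 subset_UNIV)
  ultimately have "card {b::'a. quad_diff k 0 b = 0} + 2 = 2 ^ (3 * k)"
    by (simp add: card)
  then have "int (card {b::'a. quad_diff k 0 b = 0} + 2) = int (2 ^ (3 * k))"
    by (simp only:)
  moreover have "int (card {b::'a. quad_diff k c b = 0}) = 2 ^ (3 * k) - 2 ^ (2 * k - 1)"
    if "c \<in> trace_kernel k - {0}" for c
  proof -
    have "card {b. quad_diff k c b = 0} + 2 ^ (2 * k - 1) = 2 ^ (3 * k)"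
      using card_quad_diff(3)[OF card k, of c] that by blast
    then have "int (card {b. quad_diff k c b = 0} + 2 ^ (2 * k - 1)) = int (2 ^ (3 * k))"
      by (simp only:)
    then show ?thesis by simp
  qed
  \<comment> \<open>The parameter \<open>c = 0\<close> contributes all \<open>b\<close> except
    \<open>0\<close> and \<open>1\<close>; each of the other \<open>2 ^ (2 * k) - 1\<close>
    parameters contributes equally.\<close>
  ultimately have "int (weight_multiplicity (trace_one k :: 'a set) (trace_code k) w)
      = 2 ^ (3 * k) - 2 + (2 ^ (2 * k) - 1) * (2 ^ (3 * k) - 2 ^ (2 * k - 1))"
    using weight_multiplicity_trace_code[of w 0] assms by (simp add: card_trace_kernel_nonzero)
  also have "\<dots> = 2 ^ (2 * k + 3 * k) - 2 ^ (2 * k + (2 * k - 1)) + 2 ^ (2 * k - 1) - 2"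
    unfolding power_add by (simp add: algebra_simps)
  also have "2 * k + (2 * k - 1) = 4 * k - 1" using k by simp
  finally show ?thesis by simp
qed

lemma weight_multiplicity_other:
  assumes v: "4 * int w = 2 ^ (3 * k) + v"
    and "v \<notin> {0, 2 * 2 ^ (2 * k), - (2 * 2 ^ (2 * k)), 2 ^ (3 * k), - (2 ^ (3 * k))}"
  shows "weight_multiplicity (trace_one k :: 'a set) (trace_code k) w = 0"
proof -
  have "{b::'a. quad_diff k 0 b = v} = {}"
    using assms(2) by (auto simp: quad_diff_0[OF card k])
  moreover have "quad_diff k c b \<noteq> v" if "c \<in> trace_kernel k - {0}" for c b :: 'a
    using quad_diff_cases[OF card k, of c b] that assms(2) by auto
  ultimately show ?thesis using weight_multiplicity_trace_code[OF assms(1)] by simp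
qed

text \<open>The frequency count supplies, for any nonzero \<open>c\<close>, some \<open>b\<close> at
  the lowest value of \<open>quad_diff\<close>; nonzero words with \<open>c = 0\<close> do not go
  below it. The distance is given through its fourfold to stay clear of natural subtraction.\<close>

lemma binary_code_trace_code:
  assumes d: "4 * int d = 2 ^ (3 * k) - 2 * 2 ^ (2 * k)"
  shows "binary_code (trace_one k) (trace_code k :: ('a \<Rightarrow> bit) set) (2 ^ (3 * k - 1)) (5 * k) d"
proof -
  have "has_min_dist (trace_one k) (trace_code k :: ('a \<Rightarrow> bit) set) d"
    unfolding has_min_dist_iff_weight[OF subspace_trace_code]
  proof
    have "1 < (2::nat) ^ (2 * k)" using k by (intro one_less_power) auto
    then have "\<not> (trace_kernel k :: 'a set) \<subseteq> {0}"
      using card_mono[of "{0::'a}" "trace_kernel k"] card_trace_kernel[OF card k] by auto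
    then obtain c :: 'a where c: "c \<in> trace_kernel k" "c \<noteq> 0" by auto
    then have "card {b. quad_diff k c b = - (2 * 2 ^ (2 * k))} \<noteq> 0"
      using card_quad_diff(2)[OF card k c] by (metis mult_0_right power_not_zero zero_neq_numeral)
    then have "{b. quad_diff k c b = - (2 * 2 ^ (2 * k))} \<noteq> {}" by (metis card.empty)
    then obtain b where b: "quad_diff k c b = - (2 * 2 ^ (2 * k))" by blast
    have "hamming_weight (trace_one k) (code_word k c b) = d"
      using hamming_weight_code_word[of c b] b d by simp
    moreover have "code_word k c b \<noteq> 0"
      using inj_onD[OF inj_code_word, of "(c, b)" "(0, 0)"] c zero_in_trace_kernel code_word_0 by auto
    ultimately show "\<exists>v\<in>trace_code k. v \<noteq> 0 \<and> hamming_weight (trace_one k :: 'a set) v = d"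
      using c unfolding trace_code_def by blast
    show "\<forall>v\<in>trace_code k. v \<noteq> 0 \<longrightarrow> d \<le> hamming_weight (trace_one k :: 'a set) v"
    proof (intro ballI impI)
      fix v :: "'a \<Rightarrow> bit" assume v: "v \<in> trace_code k" "v \<noteq> 0"
      then obtain c b where cb: "v = code_word k c b" "c \<in> trace_kernel k"
        by (auto simp: trace_code_def)
      have nz: "(c, b) \<noteq> (0, 0)" using v(2) cb(1) code_word_0 by auto
      have "- (2 * 2 ^ (2 * k)) \<le> quad_diff k c b"
      proof (cases "c = 0")
        case True
        then have "quad_diff k c b = 2 ^ (3 * k) \<or> quad_diff k c b = 0"
          using nz by (auto simp: quad_diff_0[OF card k])
        then show ?thesis using power_bounds by linarith
      next
        case False
        then show ?thesis using quad_diff_cases[OF card k cb(2) False, of b] by auto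
      qed
      then show "d \<le> hamming_weight (trace_one k) v"
        using hamming_weight_code_word[of c b] d unfolding cb(1) by linarith
    qed
  qed
  then show ?thesis
    by (simp add: binary_code_def card_trace_one trace_code_subset subspace_trace_code dim_trace_code)
qed

section \<open>The dual code\<close>

lemma hamming_weight_dual_ge_4:
  fixes v :: "'a \<Rightarrow> bit"
  assumes v: "v \<in> dual_code (trace_one k) (trace_code k)" "v \<noteq> 0"
  shows "4 \<le> hamming_weight (trace_one k) v"
proof -
  define S where "S = {x \<in> trace_one k. v x \<noteq> 0}"
  have orth: "(\<Sum>x\<in>S. abs_trace (3 * k) (b * x)) = 0" for b
  proof -
    have "code_word k 0 b \<in> trace_code k"
      using zero_in_trace_kernel by (auto simp: trace_code_def)
    then have "0 = (\<Sum>x\<in>trace_one k. v x * code_word k 0 b x)"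
      using v by (auto simp: dual_code_def)
    also have "\<dots> = (\<Sum>x\<in>S. abs_trace (3 * k) (b * x))"
      by (rule sum.mono_neutral_cong_right) (auto simp: S_def code_word_def quad_form_def)
    finally show ?thesis by simp
  qed
  have "abs_trace (3 * k) (b * \<Sum>S) = 0" for b
    using orth[of b] by (simp add: sum_distrib_left abs_trace_sum[OF card])
  then have S0: "\<Sum>S = 0" using abs_trace_nondegenerate[OF card, of "\<Sum>S"] by simp
  \<comment> \<open>Orthogonality to the all-one word, obtained at \<open>b = 1\<close>, gives the
    parity of the support.\<close>
  have "(\<Sum>x\<in>S. abs_trace (3 * k) (1 * x)) = (\<Sum>x\<in>S. 1)"
    by (rule sum.cong) (auto simp: S_def trace_one_iff)
  then have "of_nat (card S) = (0::bit)" using orth[of 1] by simp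
  then have "even (card S)" by (metis even_of_nat even_zero)
  moreover have "card S \<noteq> 0"
    using v by (auto simp: S_def dual_code_def words_def fun_eq_iff)
  moreover have "card S \<noteq> 2"
  proof
    assume "card S = 2"
    then obtain x y where "S = {x, y}" "x \<noteq> y" by (auto simp: card_2_iff)
    with S0 show False by (simp add: char_two_add_eq_0_iff[OF card])
  qed
  ultimately have "4 \<le> card S" by presburger
  then show ?thesis by (simp add: hamming_weight_def S_def)
qed

text \<open>No word of weight \<open>4\<close> is constructed: the dual is nonzero, hence has some
  minimum distance, which the parity argument and sphere packing confine to
  \<open>4\<close>.\<close>

lemma binary_code_dual_trace_code:
  assumes k3: "3 \<le> k"
  shows "binary_code (trace_one k) (dual_code (trace_one k) (trace_code k :: ('a \<Rightarrow> bit) set))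
    (2 ^ (3 * k - 1)) (2 ^ (3 * k - 1) - 5 * k) 4"
proof -
  let ?C = "dual_code (trace_one k) (trace_code k :: ('a \<Rightarrow> bit) set)"
  have sub: "?C \<subseteq> words (trace_one k)" by (auto simp: dual_code_def)
  have dim: "word.dim ?C = 2 ^ (3 * k - 1) - 5 * k"
    using dim_dual_code[OF _ trace_code_subset subspace_trace_code]
    by (simp add: card_trace_one dim_trace_code)
  have code: "binary_code (trace_one k) ?C (2 ^ (3 * k - 1)) (2 ^ (3 * k - 1) - 5 * k) d"
    if "has_min_dist (trace_one k) ?C d" for d
    using that sub dim by (simp add: binary_code_def card_trace_one subspace_dual_code)
  have "card ?C = 2 ^ (2 ^ (3 * k - 1) - 5 * k)"
    using card_subspace[OF finite_subset[OF sub finite_words] subspace_dual_code] dim by simp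
  moreover have "1 < (2::nat) ^ (2 ^ (3 * k - 1) - 5 * k)"
    using code_length_bound[OF k3] by (intro one_less_power) auto
  ultimately have "\<not> ?C \<subseteq> {0}"
    using card_mono[of "{0}" ?C] by auto
  then obtain u where u: "u \<in> ?C" "u \<noteq> 0" by blast
  then obtain d where d: "has_min_dist (trace_one k) ?C d"
    using ex_min_dist[OF u(1) word.subspace_0[OF subspace_dual_code]] by blast
  moreover have "4 \<le> d"
    using d hamming_weight_dual_ge_4 unfolding has_min_dist_iff_weight[OF subspace_dual_code] by blast
  moreover have "d \<le> 4"
    using min_dist_le_4[OF code[OF d] k3] .
  ultimately show ?thesis using code by (metis le_antisym)
qed

end

section \<open>Parameters, weight distribution and optimality in terms of \<open>m\<close>\<close>

theorem theorem4p5: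
  fixes m t1 t2 :: nat
    and f :: "'a::finite_field \<Rightarrow> 'a"
    and D :: "'a set"
    and C :: "('a \<Rightarrow> bit) set"
  assumes card: "CARD('a) = 2 ^ m"
    and m: "m \<ge> 9" "3 dvd m"
    and t1: "t1 \<in> {2 ^ (m div 3) + 1, 2 ^ (2 * m div 3) + 1, 2 ^ (2 * m div 3) + 2 ^ (m div 3)}"
    and t2: "t2 \<in> {2 ^ (m div 3) + 1, 2 ^ (2 * m div 3) + 1, 2 ^ (2 * m div 3) + 2 ^ (m div 3)}"
    and neq: "t1 \<noteq> t2"
    and f: "f = (\<lambda>x. x ^ t1 + x ^ t2)"
    and D: "D = {x. x \<noteq> 0 \<and> abs_trace m x = 1}"
    and C: "C = punctured_code m f D"
  shows "binary_code D C (2 ^ (m - 1)) (5 * m div 3) (2 ^ (m - 2) - 2 ^ (2 * m div 3 - 1))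
    \<and> weight_multiplicity D C 0 = 1
    \<and> int (weight_multiplicity D C (2 ^ (m - 2)))
        = 2 ^ (5 * m div 3) - 2 ^ (4 * m div 3 - 1) + 2 ^ (2 * m div 3 - 1) - 2
    \<and> int (weight_multiplicity D C (2 ^ (m - 2) - 2 ^ (2 * m div 3 - 1)))
        = 2 ^ (4 * m div 3 - 2) - 2 ^ (2 * m div 3 - 2)
    \<and> int (weight_multiplicity D C (2 ^ (m - 2) + 2 ^ (2 * m div 3 - 1)))
        = 2 ^ (4 * m div 3 - 2) - 2 ^ (2 * m div 3 - 2)
    \<and> weight_multiplicity D C (2 ^ (m - 1)) = 1
    \<and> (\<forall>w. w \<notin> {0, 2 ^ (m - 2), 2 ^ (m - 2) - 2 ^ (2 * m div 3 - 1),
              2 ^ (m - 2) + 2 ^ (2 * m div 3 - 1), 2 ^ (m - 1)}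
           \<longrightarrow> weight_multiplicity D C w = 0)
    \<and> binary_code D (dual_code D C) (2 ^ (m - 1)) (2 ^ (m - 1) - 5 * m div 3) 4
    \<and> distance_optimal D (dual_code D C) (2 ^ (m - 1)) (2 ^ (m - 1) - 5 * m div 3) 4"
proof -
  obtain k where mk: "m = 3 * k" using m(2) by blast
  have k3: "3 \<le> k" and k2: "2 \<le> k" using m(1) mk by auto
  note card = card[unfolded mk]
  have exps: "m div 3 = k" "2 * m div 3 = 2 * k" "4 * m div 3 = 4 * k" "5 * m div 3 = 5 * k"
    by (simp_all add: mk)
  have DT: "D = trace_one k" by (simp add: D trace_one_def mk)
  obtain \<phi> where "range \<phi> = trace_kernel k"
    "\<And>a x. abs_trace (3 * k) (a * f x) = abs_trace (3 * k) (\<phi> a * (x * frob k x))"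
    using ex_trace_kernel_param[OF card k2 _ _ neq f] t1 t2 unfolding exps by blast
  then have CT: "C = trace_code k"
    using punctured_code_eq[OF card k2] by (simp add: C DT mk)
  let ?M = "2 ^ (3 * k - 2) :: nat" and ?Q = "2 ^ (2 * k - 1) :: nat"
  have "(2::int) ^ (3 * k) = 4 * 2 ^ (3 * k - 2)"
    using k2 by (intro two_power_eq_4_mult) simp
  moreover have "(2::int) ^ (3 * k) = 2 * 2 ^ (3 * k - 1)" "(2::int) ^ (2 * k) = 2 * 2 ^ (2 * k - 1)"
    using k2 power_eq_if[of "2::int" "3 * k"] power_eq_if[of "2::int" "2 * k"] by simp_all
  ultimately have pow: "(2::int) ^ (3 * k) = 4 * 2 ^ (3 * k - 2)"
    "(2::int) ^ (3 * k) = 2 * 2 ^ (3 * k - 1)" "(2::int) ^ (2 * k) = 2 * 2 ^ (2 * k - 1)"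
    by blast+
  \<comment> \<open>Ensures that the natural subtraction in the lower weight does not
    truncate.\<close>
  have le: "?Q \<le> ?M" using k2 by (intro power_increasing) auto
  have weights: "4 * int ?M = 2 ^ (3 * k)" "4 * int (?M - ?Q) = 2 ^ (3 * k) - 2 * 2 ^ (2 * k)"
    "4 * int (?M + ?Q) = 2 ^ (3 * k) + 2 * 2 ^ (2 * k)" "4 * int (2 ^ (3 * k - 1)) = 2 ^ (3 * k) + 2 ^ (3 * k)"
    using pow by (simp_all add: of_nat_diff[OF le])
  have other: "weight_multiplicity D C w = 0" if w: "w \<notin> {0, ?M, ?M - ?Q, ?M + ?Q, 2 ^ (3 * k - 1)}" for w
    unfolding DT CT
  proof (rule weight_multiplicity_other[OF card k2, of w "4 * int w - 2 ^ (3 * k)"])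
    have neq: "4 * int w \<noteq> 4 * int x" if "x \<in> {0, ?M, ?M - ?Q, ?M + ?Q, 2 ^ (3 * k - 1)}" for x
      using w that by auto
    have "4 * int w \<noteq> 0" "4 * int w \<noteq> 2 ^ (3 * k)" "4 * int w \<noteq> 2 ^ (3 * k) - 2 * 2 ^ (2 * k)"
      "4 * int w \<noteq> 2 ^ (3 * k) + 2 * 2 ^ (2 * k)" "4 * int w \<noteq> 2 ^ (3 * k) + 2 ^ (3 * k)"
      using neq[of 0] neq[of ?M] neq[of "?M - ?Q"] neq[of "?M + ?Q"] neq[of "2 ^ (3 * k - 1)"]
      unfolding weights by simp_all
    then show "4 * int w - 2 ^ (3 * k) \<notin> {0, 2 * 2 ^ (2 * k), - (2 * 2 ^ (2 * k)), 2 ^ (3 * k), - (2 ^ (3 * k))}"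
      by (simp add: algebra_simps)
  qed simp
  have "binary_code D C (2 ^ (3 * k - 1)) (5 * k) (?M - ?Q)"
    unfolding DT CT by (rule binary_code_trace_code[OF card k2]) (rule weights)
  moreover have "weight_multiplicity D C 0 = 1"
    unfolding DT CT by (rule weight_multiplicity_extreme[OF card k2, of 0 "- (2 ^ (3 * k))"]) simp_all
  moreover have "weight_multiplicity D C (2 ^ (3 * k - 1)) = 1"
    unfolding DT CT by (rule weight_multiplicity_extreme[OF card k2 weights(4)]) simp
  moreover have "int (weight_multiplicity D C ?M) = 2 ^ (5 * k) - 2 ^ (4 * k - 1) + 2 ^ (2 * k - 1) - 2"
    unfolding DT CT by (rule weight_multiplicity_middle[OF card k2 weights(1)])
  moreover have "int (weight_multiplicity D C (?M - ?Q)) = 2 ^ (4 * k - 2) - 2 ^ (2 * k - 2)"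
    unfolding DT CT
    by (rule weight_multiplicity_side[OF card k2, of _ "- (2 * 2 ^ (2 * k))"]) (use weights(2) in simp_all)
  moreover have "int (weight_multiplicity D C (?M + ?Q)) = 2 ^ (4 * k - 2) - 2 ^ (2 * k - 2)"
    unfolding DT CT by (rule weight_multiplicity_side[OF card k2 weights(3)]) simp
  moreover have dual: "binary_code D (dual_code D C) (2 ^ (3 * k - 1)) (2 ^ (3 * k - 1) - 5 * k) 4"
    unfolding DT CT by (rule binary_code_dual_trace_code[OF card k2 k3])
  moreover have "distance_optimal D (dual_code D C) (2 ^ (3 * k - 1)) (2 ^ (3 * k - 1) - 5 * k) 4"
    \<comment> \<open>The sphere packing consequence is applied to the competing code over
      \<open>{..<n}\<close>.\<close>
    unfolding distance_optimal_def using dual min_dist_le_4[OF _ k3] by fastforce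
  ultimately show ?thesis
    unfolding exps unfolding mk using other by blast
qed

end
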